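(* Let $f:\mathbb{R}^{m\times n}\to\mathbb{R}$ be continuously differentiable and consider the problem (rank-MOA): minimize $f(X)$ subject to $X\in\mathcal{L}\cap\mathbb{R}(r)$. Let $X\in\mathcal{L}\cap\mathbb{R}(r)$ with $\mathrm{rank}(X)=s$, with a fixed singular value decomposition $X=U\Sigma(X)V^\top$. (i) Suppose that $X$ is a local minimizer of (rank-MOA). If either $s=r$ and Assumption 1 holds at $X$ (the matrices $T^1_X,\dots,T^l_X$ are linearly independent), or $s<r$, Assumption 2 holds at $X$ (the matrices $R^1_X,\dots,R^l_X$ are linearly independent) and $\mathrm{N}^F_{\mathbb{R}_X(r)}(X)\subseteq\mathrm{T}_{\mathcal{L}}(X)$, then $X$ is an $F$-stationary point of (rank-MOA). (ii) Suppose that $f$ is convex and $X$ is an $F$-stationary point of (rank-MOA). If $s=r$, then $X$ is a global minimizer of (rank-MOA) restricted on $\mathbb{R}_X(\Gamma)$, i.e. $f(X)\le f(Y)$ for all $Y\in\mathcal{L}\cap\mathbb{R}(r)\cap\mathbb{R}_X(\Gamma)$. If $s<r$, then $X$ is a global minimizer of (rank-MOA).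
   Context: Let $m\ge n$ and $1\le r<n$ be integers. $\mathbb{R}^{m\times n}$ carries the inner product $\langle X,Y\rangle=\sum_{ij}X_{ij}Y_{ij}$ and Frobenius norm $\|\cdot\|_F$. Given $A^1,\dots,A^l\in\mathbb{R}^{m\times n}$ and $b_1,\dots,b_l\in\mathbb{R}$, set $\mathcal{L}=\{X\in\mathbb{R}^{m\times n}:\langle A^i,X\rangle=b_i,\ i=1,\dots,l\}$ and $\mathbb{R}(r)=\{X\in\mathbb{R}^{m\times n}:\mathrm{rank}(X)\le r\}$. Cones. The polar of a cone $\mathcal{K}$ is $\mathcal{K}^\circ=\{Y:\langle Y,X\rangle\le 0\ \forall X\in\mathcal{K}\}$. For a nonempty closed set $\Omega\subseteq\mathbb{R}^{m\times n}$ and $X\in\Omega$, the Bouligand tangent cone $\mathrm{T}^B_\Omega(X)$ is the set of all $\Xi$ for which there are $X^k\in\Omega$ with $X^k\to X$ and $t_k>0$ with $t_k\to0$ such that $t_k^{-1}(X^k-X)\to\Xi$; the Fréchet normal cone is $\mathrm{N}^F_\Omega(X)=[\mathrm{T}^B_\Omega(X)]^\circ$. For the affine set $\mathcal{L}$ one writes $\mathrm{T}_{\mathcal{L}}(X)=\mathrm{T}^B_{\mathcal{L}}(X)$. SVD and the set $\mathbb{R}_X(r)$. For $X\in\mathbb{R}^{m\times n}$ of rank $s$ fix an SVD $X=U\Sigma(X)V^\top$, with $U\in\mathbb{R}^{m\times m}$, $V\in\mathbb{R}^{n\times n}$ orthogonal and $\Sigma(X)$ the (rectangular) diagonal $m\times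 n$ matrix of singular values; $\Gamma\subseteq\{1,\dots,n\}$, $|\Gamma|=s$, is the index set of the nonzero singular values, $\Gamma_m^\perp=\{1,\dots,m\}\setminus\Gamma$, $\Gamma_n^\perp=\{1,\dots,n\}\setminus\Gamma$. For an index set $J$, $U_J$ (resp. $V_J$) is the submatrix of columns of $U$ (resp. $V$) indexed by $J$. Let $\mathcal{J}=\{J\subseteq\{1,\dots,n\}:|J|=r,\ \Gamma\subseteq J\}$, $\mathbb{R}_X(J)=\{U_JAV_J^\top:A\in\mathbb{R}^{r\times r}\}$ for $J\in\mathcal{J}$, and $\mathbb{R}_X(r)=\bigcup_{J\in\mathcal{J}}\mathbb{R}_X(J)$ (these depend on the chosen $U,V$). If $s=r$ then $\mathcal{J}=\{\Gamma\}$ and $\mathbb{R}_X(r)=\mathbb{R}_X(\Gamma)$. For $i=1,\dots,l$ define the block matrices $$T^i_X=\begin{bmatrix}U_\Gamma^\top A^iV_\Gamma & U_\Gamma^\top A^iV_{\Gamma_n^\perp}\\ U_{\Gamma_m^\perp}^\top A^iV_\Gamma & 0\end{bmatrix},\qquad R^i_X=\begin{bmatrix}U_\Gamma^\top A^iV_\Gamma & 0\\ 0&0\end{bmatrix}.$$ Stationarity. The Lagrangian is $L(X,y)=f(X)+\sum_{i=1}^l y_i(\langle A^i,X\rangle-b_i)$, so $\nabla_XL(X,y)=\nabla f(X)+\sum_i y_iA^i$. A matrix $X\in\mathbb{R}(r)$ is an $F$-stationary point of (rank-MOA) if there is $y\in\mathbb{R}^l$ with $\langle A^i,X\rangle=b_i$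 for all $i$ and $-\nabla_XL(X,y)\in\mathrm{N}^F_{\mathbb{R}(r)}(X)$. *)

theory Defs
  imports "HOL-Analysis.Analysis"
begin

text \<open>
  An m by n real matrix is an element of \<open>real^'n^'m\<close>. On this type the library's
  \<open>inner\<close> is the entrywise inner product, so \<open>norm\<close> is the Frobenius norm.
  Families of matrices and of scalars with l members are functions on \<open>nat\<close>, of which
  only the values on \<open>{1..l}\<close> are used.
\<close>

definition affine_constraints ::
    "nat \<Rightarrow> (nat \<Rightarrow> real^'n^'m) \<Rightarrow> (nat \<Rightarrow> real) \<Rightarrow> (real^'n^'m) set" where
  "affine_constraints l A b = {X. \<forall>i\<in>{1..l}. A i \<bullet> X = b i}"

definition rank_le :: "nat \<Rightarrow> (real^'n^'m) set" where
  "rank_le r = {X. rank X \<le> r}"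

definition polar :: "'a::real_inner set \<Rightarrow> 'a set" where
  "polar K = {Y. \<forall>X\<in>K. Y \<bullet> X \<le> 0}"

definition bouligand_tangent_cone :: "'a::real_normed_vector set \<Rightarrow> 'a \<Rightarrow> 'a set" where
  "bouligand_tangent_cone \<Omega> X =
     {\<Xi>. \<exists>(Xs :: nat \<Rightarrow> 'a) (t :: nat \<Rightarrow> real).
          (\<forall>k. Xs k \<in> \<Omega>) \<and> Xs \<longlonglongrightarrow> X \<and>
          (\<forall>k. t k > 0) \<and> t \<longlonglongrightarrow> 0 \<and>
          (\<lambda>k. inverse (t k) *\<^sub>R (Xs k - X)) \<longlonglongrightarrow> \<Xi>}"

definition frechet_normal_cone :: "'a::real_inner set \<Rightarrow> 'a \<Rightarrow> 'a set" where
  "frechet_normal_cone \<Omega> X = polar (bouligand_tangent_cone \<Omega> X)"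

text \<open>
  The index sets \<open>{1..m}\<close> and \<open>{1..n}\<close> are the types \<open>'m\<close> and \<open>'n\<close>. The inclusion of
  \<open>{1..n}\<close> in \<open>{1..m}\<close> becomes an injection \<open>\<iota> :: 'n \<Rightarrow> 'm\<close>, which is carried around
  as a parameter: a set \<open>J\<close> of column indices, regarded as a set of row indices, is
  \<open>\<iota> ` J\<close>. The diagonal of a rectangular matrix consists of the positions \<open>(\<iota> q, q)\<close>.
\<close>

definition rect_diag :: "('n \<Rightarrow> 'm) \<Rightarrow> real^'n \<Rightarrow> real^'n^'m" where
  "rect_diag \<iota> \<sigma> = (\<chi> p q. if p = \<iota> q then \<sigma> $ q else 0)"

text \<open>
  No order is imposed on the singular values, so the set \<open>nonzero_sv \<sigma>\<close> of indices of
  nonzero singular values (Gamma in the literature) need not be an initial segment.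
\<close>

definition is_svd ::
    "('n::finite \<Rightarrow> 'm::finite) \<Rightarrow> real^'n^'m \<Rightarrow> real^'m^'m \<Rightarrow> real^'n \<Rightarrow> real^'n^'n \<Rightarrow> bool" where
  "is_svd \<iota> X U \<sigma> V \<longleftrightarrow>
     inj \<iota> \<and> orthogonal_matrix U \<and> orthogonal_matrix V \<and> (\<forall>q. \<sigma> $ q \<ge> 0) \<and>
     X = U ** rect_diag \<iota> \<sigma> ** transpose V"

definition nonzero_sv :: "real^'n \<Rightarrow> 'n set" where
  "nonzero_sv \<sigma> = {q. \<sigma> $ q \<noteq> 0}"

text \<open>
  The product \<open>U_J M V_J^T\<close>, written out entrywise. The matrix \<open>M\<close> is indexed by
  \<open>J \<times> J\<close>; its values elsewhere are irrelevant.
\<close>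

definition RXJ ::
    "('n::finite \<Rightarrow> 'm::finite) \<Rightarrow> real^'m^'m \<Rightarrow> real^'n^'n \<Rightarrow> 'n set \<Rightarrow> (real^'n^'m) set" where
  "RXJ \<iota> U V J =
     {\<chi> i k. \<Sum>p\<in>J. \<Sum>q\<in>J. U $ i $ \<iota> p * M p q * V $ k $ q | M :: 'n \<Rightarrow> 'n \<Rightarrow> real. True}"

definition RX ::
    "('n::finite \<Rightarrow> 'm::finite) \<Rightarrow> real^'m^'m \<Rightarrow> real^'n \<Rightarrow> real^'n^'n \<Rightarrow> nat \<Rightarrow> (real^'n^'m) set" where
  "RX \<iota> U \<sigma> V r = (\<Union>J\<in>{J. card J = r \<and> nonzero_sv \<sigma> \<subseteq> J}. RXJ \<iota> U V J)"

text \<open>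
  The block matrices \<open>T\<^sup>i\<close> and \<open>R\<^sup>i\<close> for one matrix \<open>A\<close>. The entry \<open>(p, q)\<close> of
  \<open>transpose U ** A ** V\<close> is the product of column \<open>p\<close> of \<open>U\<close>, \<open>A\<close> and column \<open>q\<close> of \<open>V\<close>.
  The blocks are therefore cut out of this matrix by the row indices in \<open>\<iota> ` nonzero_sv \<sigma>\<close>
  or its complement, and the column indices in \<open>nonzero_sv \<sigma>\<close> or its complement.
\<close>

definition T_block ::
    "('n::finite \<Rightarrow> 'm::finite) \<Rightarrow> real^'m^'m \<Rightarrow> real^'n \<Rightarrow> real^'n^'n \<Rightarrow> real^'n^'m \<Rightarrow> real^'n^'m" where
  "T_block \<iota> U \<sigma> V A =
     (\<chi> p q. if p \<in> \<iota> ` nonzero_sv \<sigma> \<or> q \<in> nonzero_sv \<sigma>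
             then (transpose U ** A ** V) $ p $ q else 0)"

definition R_block ::
    "('n::finite \<Rightarrow> 'm::finite) \<Rightarrow> real^'m^'m \<Rightarrow> real^'n \<Rightarrow> real^'n^'n \<Rightarrow> real^'n^'m \<Rightarrow> real^'n^'m" where
  "R_block \<iota> U \<sigma> V A =
     (\<chi> p q. if p \<in> \<iota> ` nonzero_sv \<sigma> \<and> q \<in> nonzero_sv \<sigma>
             then (transpose U ** A ** V) $ p $ q else 0)"

text \<open>
  Linear independence of the family \<open>B 1, ..., B l\<close>. Independence of the set of its
  members would not exclude repetitions, hence the injectivity.
\<close>

definition independent_family :: "nat \<Rightarrow> (nat \<Rightarrow> 'a::real_vector) \<Rightarrow> bool" where
  "independent_family l B \<longleftrightarrow> inj_on B {1..l} \<and> independent (B ` {1..l})"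

definition assumption1 ::
    "('n::finite \<Rightarrow> 'm::finite) \<Rightarrow> real^'m^'m \<Rightarrow> real^'n \<Rightarrow> real^'n^'n \<Rightarrow>
     nat \<Rightarrow> (nat \<Rightarrow> real^'n^'m) \<Rightarrow> bool" where
  "assumption1 \<iota> U \<sigma> V l A \<longleftrightarrow> independent_family l (\<lambda>i. T_block \<iota> U \<sigma> V (A i))"

definition assumption2 ::
    "('n::finite \<Rightarrow> 'm::finite) \<Rightarrow> real^'m^'m \<Rightarrow> real^'n \<Rightarrow> real^'n^'n \<Rightarrow>
     nat \<Rightarrow> (nat \<Rightarrow> real^'n^'m) \<Rightarrow> bool" where
  "assumption2 \<iota> U \<sigma> V l A \<longleftrightarrow> independent_family l (\<lambda>i. R_block \<iota> U \<sigma> V (A i))"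

definition continuously_differentiable :: "('a::real_inner \<Rightarrow> real) \<Rightarrow> bool" where
  "continuously_differentiable f \<longleftrightarrow>
     (\<exists>g. (\<forall>X. GDERIV f X :> g X) \<and> continuous_on UNIV g)"

definition lagrangian ::
    "(real^'n^'m \<Rightarrow> real) \<Rightarrow> nat \<Rightarrow> (nat \<Rightarrow> real^'n^'m) \<Rightarrow> (nat \<Rightarrow> real) \<Rightarrow>
     real^'n^'m \<Rightarrow> (nat \<Rightarrow> real) \<Rightarrow> real" where
  "lagrangian f l A b X y = f X + (\<Sum>i=1..l. y i * (A i \<bullet> X - b i))"

definition F_stationary ::
    "(real^'n^'m \<Rightarrow> real) \<Rightarrow> nat \<Rightarrow> (nat \<Rightarrow> real^'n^'m) \<Rightarrow> (nat \<Rightarrow> real) \<Rightarrow> nat \<Rightarrow>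
     real^'n^'m \<Rightarrow> bool" where
  "F_stationary f l A b r X \<longleftrightarrow>
     X \<in> rank_le r \<and>
     (\<exists>y G. (\<forall>i\<in>{1..l}. A i \<bullet> X = b i) \<and>
            GDERIV (\<lambda>Z. lagrangian f l A b Z y) X :> G \<and>
            - G \<in> frechet_normal_cone (rank_le r) X)"

definition local_minimizer_on :: "('a::metric_space \<Rightarrow> real) \<Rightarrow> 'a set \<Rightarrow> 'a \<Rightarrow> bool" where
  "local_minimizer_on f S X \<longleftrightarrow>
     X \<in> S \<and> (\<exists>\<epsilon>>0. \<forall>Y\<in>S. dist Y X < \<epsilon> \<longrightarrow> f X \<le> f Y)"

definition global_minimizer_on :: "('a \<Rightarrow> real) \<Rightarrow> 'a set \<Rightarrow> 'a \<Rightarrow> bool" where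
  "global_minimizer_on f S X \<longleftrightarrow> X \<in> S \<and> (\<forall>Y\<in>S. f X \<le> f Y)"

end

theory Submission
  imports Defs
begin

text \<open>
  Full rank, part (i): every \<open>K ** X ** H\<close> has rank at most \<open>rank X\<close>, so \<open>(mat 1, mat 1)\<close> is a
  local minimizer of the pulled back problem in \<open>(K, H)\<close>, which has affine domain. Assumption 1
  makes the gradients of its constraints independent, and the multiplier rule (a consequence of
  the open mapping property of maps with surjective derivative) gives
  \<open>G ** transpose X = 0\<close> and \<open>transpose X ** G = 0\<close> for the gradient \<open>G\<close> of the Lagrangian.
  Such a \<open>G\<close> is orthogonal to the tangent cone of the matrices of bounded rank.

  Deficient rank, part (i): on each subspace \<open>RXJ \<iota> U V J\<close> linear algebra yields multipliers, and
  Assumption 2 makes them independent of \<open>J\<close>. A rank-one direction \<open>u\<^sub>p v\<^sub>q\<^sup>T\<close> in none of these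
  subspaces lies in the normal cone, hence is feasible by hypothesis, and \<open>f\<close> is stationary along
  it. So \<open>G\<close> annihilates all \<open>u\<^sub>p v\<^sub>q\<^sup>T\<close> and vanishes.

  Part (ii): when the rank is deficient, the tangent cone contains all rank-one matrices and
  \<open>G = 0\<close>; in the full rank case it contains the subspace \<open>RXJ\<close> of the singular indices. Convexity
  of \<open>f\<close> does the rest.
\<close>

section \<open>Lagrange multiplier rules\<close>

text \<open>If the derivative of \<open>(h, c)\<close> were surjective, the map would be open at
  \<open>x\<close> and would take values with the same \<open>c\<close> and a smaller
  \<open>h\<close> near \<open>x\<close>. So its range lies in a hyperplane, whose normal vector
  supplies the multiplier.\<close>

lemma lagrange_multiplier_surjective:
  fixes h :: "'a::euclidean_space \<Rightarrow> real" and c :: "'a \<Rightarrow> 'b::euclidean_space"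
  assumes h: "continuous_on UNIV h" "(h has_derivative h') (at x)"
    and c: "continuous_on UNIV c" "(c has_derivative c') (at x)" "surj c'"
    and "e > 0" and min: "\<And>z. c z = c x \<Longrightarrow> dist z x < e \<Longrightarrow> h x \<le> h z"
  obtains \<eta> where "\<And>d. h' d = \<eta> \<bullet> c' d"
proof -
  define F where "F z = (h z, c z)" for z
  define F' where "F' d = (h' d, c' d)" for d
  have derF: "(F has_derivative F') (at x)"
    unfolding F_def F'_def using h c by (intro has_derivative_Pair)
  then have linF: "linear F'" by (rule has_derivative_linear)
  have not_surj: "\<not> surj F'"
  proof
    assume "surj F'"
    then obtain g where g: "linear g" "F' \<circ> g = id"
      using linear_surjective_right_inverse[OF linF] by auto
    have "F x \<in> interior (F ` ball x e)"
    proof (rule sussmann_open_mapping)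
      show "continuous_on UNIV F"
        unfolding F_def using h c by (intro continuous_on_Pair)
      show "bounded_linear g" using g by (simp add: linear_conv_bounded_linear)
    qed (use derF g \<open>e > 0\<close> in auto)
    then obtain \<delta> where \<delta>: "\<delta> > 0" "cball (F x) \<delta> \<subseteq> F ` ball x e"
      by (auto simp: mem_interior_cball)
    have "(h x - \<delta>, c x) \<in> cball (F x) \<delta>"
      using \<delta> by (simp add: F_def dist_Pair_Pair dist_real_def)
    then obtain z where "z \<in> ball x e" "F z = (h x - \<delta>, c x)"
      using \<delta> by (metis (no_types, lifting) imageE subset_eq)
    then show False
      using min[of z] \<delta> by (auto simp: F_def dist_commute)
  qed
  have "span (range F') = range F'"
    using linF by (simp add: linear_subspace_image span_eq_iff)
  then have "dim (range F') < DIM(real \<times> 'b)"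
    using not_surj dim_eq_full[of "range F'"] dim_subset_UNIV[of "range F'"] by fastforce
  then obtain p where "p \<noteq> 0" and "\<And>y. y \<in> span (range F') \<Longrightarrow> orthogonal p y"
    by (rule orthogonal_to_subspace_exists) auto
  then have p: "p \<bullet> F' d = 0" for d
    by (simp add: orthogonal_def span_base)
  obtain \<alpha> \<eta> where "p = (\<alpha>, \<eta>)" by force
  with p have eq: "\<alpha> * h' d + \<eta> \<bullet> c' d = 0" for d
    by (simp add: F'_def)
  \<comment> \<open>Otherwise \<open>\<eta>\<close> is orthogonal to the range of \<open>c'\<close>,
    which is the whole space and so contains \<open>\<eta>\<close> itself.\<close>
  have "\<alpha> \<noteq> 0"
  proof
    assume "\<alpha> = 0"
    moreover obtain d where "c' d = \<eta>" using \<open>surj c'\<close> by (metis surjD)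
    ultimately show False
      using eq[of d] \<open>p \<noteq> 0\<close> \<open>p = (\<alpha>, \<eta>)\<close> by (auto simp: zero_prod_def)
  qed
  then have "h' d = (- \<eta> /\<^sub>R \<alpha>) \<bullet> c' d" for d
    using eq[of d] by (simp add: field_simps add_eq_0_iff)
  then show thesis by (rule that)
qed

text \<open>The scalar constraints are packed into one vector map by weighting them with their own
  gradients. By independence this map vanishes only where each constraint keeps its value at
  \<open>x\<close>. Its derivative reaches only the span of the \<open>a i\<close>, so a second
  variable is added to fill the orthogonal complement.\<close>

lemma lagrange_multipliers:
  fixes h :: "'a::euclidean_space \<Rightarrow> real" and c :: "nat \<Rightarrow> 'a \<Rightarrow> real"
  assumes h: "continuous_on UNIV h" "GDERIV h x :> g"
    and c: "\<And>i. i \<in> {1..l} \<Longrightarrow> continuous_on UNIV (c i)"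
      "\<And>i. i \<in> {1..l} \<Longrightarrow> GDERIV (c i) x :> a i"
    and indep: "\<And>u i. (\<Sum>i=1..l. u i *\<^sub>R a i) = 0 \<Longrightarrow> i \<in> {1..l} \<Longrightarrow> u i = (0::real)"
    and "e > 0"
    and min: "\<And>z. (\<forall>i\<in>{1..l}. c i z = c i x) \<Longrightarrow> dist z x < e \<Longrightarrow> h x \<le> h z"
  obtains y where "g + (\<Sum>i=1..l. y i *\<^sub>R a i) = 0"
proof -
  define E where "E = span (a ` {1..l})"
  obtain B where B: "B \<subseteq> E" "pairwise orthogonal B" "\<And>v. v \<in> B \<Longrightarrow> norm v = 1"
      "independent B" "card B = dim E" "span B = E"
    using orthonormal_basis_subspace[of E] unfolding E_def by auto
  have finB: "finite B" using B(4) by (rule independent_imp_finite)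
  \<comment> \<open>The orthogonal projection onto the complement of \<open>E\<close>.\<close>
  define P where "P w = w - (\<Sum>v\<in>B. (v \<bullet> w) *\<^sub>R v)" for w
  have P_orth_B: "v \<bullet> P w = 0" if "v \<in> B" for v w
  proof -
    have "v \<bullet> v' = (if v' = v then 1 else 0)" if "v' \<in> B" for v'
      using B(2,3) \<open>v \<in> B\<close> that by (auto simp: pairwise_def orthogonal_def norm_eq_1)
    then have "v \<bullet> P w = v \<bullet> w - (\<Sum>v'\<in>B. (v' \<bullet> w) * (if v' = v then 1 else 0))"
      unfolding P_def inner_diff_right inner_sum_right by simp
    then show ?thesis using \<open>v \<in> B\<close> finB by (simp add: if_distrib cong: if_cong)
  qed
  have P_orth: "v \<bullet> P w = 0" if "v \<in> E" for v w
    using orthogonal_to_span[of v B "P w"] that P_orth_B B(6)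
    by (auto simp: orthogonal_def inner_commute)
  have P_bl: "bounded_linear P"
    unfolding P_def by (intro bounded_linear_intros)
  \<comment> \<open>The summand \<open>P w\<close> makes the derivative surjective; it is orthogonal to the \<open>a i\<close>, so
    \<open>C\<close> vanishes only where all the constraints hold.\<close>
  define C where "C z = (\<Sum>i=1..l. (c i (fst z) - c i x) *\<^sub>R a i) + P (snd z)" for z
  define C' where "C' d = (\<Sum>i=1..l. (fst d \<bullet> a i) *\<^sub>R a i) + P (snd d)" for d
  have C0: "\<forall>i\<in>{1..l}. c i (fst z) = c i x" if "C z = 0" for z
  proof -
    let ?u = "\<lambda>i. c i (fst z) - c i x"
    let ?s = "\<Sum>i=1..l. ?u i *\<^sub>R a i"
    have "?s \<in> E" unfolding E_def by (intro span_sum span_scale span_base) auto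
    then have "?s \<bullet> (?s + P (snd z)) = ?s \<bullet> ?s"
      by (simp add: inner_add_right P_orth)
    then have "?s = 0" using that unfolding C_def by simp
    then show ?thesis using indep[of ?u] by simp
  qed
  have derC: "(C has_derivative C') (at (x, 0))"
  proof -
    have "((\<lambda>z. (c i (fst z) - c i x) *\<^sub>R a i) has_derivative (\<lambda>d. (fst d \<bullet> a i) *\<^sub>R a i))
        (at (x, 0::'a))" if "i \<in> {1..l}" for i
    proof -
      have "(c i has_derivative (\<lambda>d. d \<bullet> a i)) (at (fst (x, 0::'a)))"
        using c(2)[OF that] by (simp add: gderiv_def)
      from has_derivative_compose[OF has_derivative_fst[OF has_derivative_ident] this]
      have "((\<lambda>z. c i (fst z) - c i x) has_derivative (\<lambda>d. fst d \<bullet> a i - 0)) (at (x, 0::'a))"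
        by (rule has_derivative_diff) (rule has_derivative_const)
      then show ?thesis
        by (intro has_derivative_scaleR_left) simp
    qed
    moreover have "((\<lambda>z. P (snd z)) has_derivative (\<lambda>d. P (snd d))) (at (x, 0))"
      by (intro bounded_linear_imp_has_derivative bounded_linear_compose[OF P_bl] bounded_linear_snd)
    ultimately show ?thesis
      unfolding C_def C'_def by (intro has_derivative_add has_derivative_sum)
  qed
  have surjC: "surj C'"
  proof (rule ccontr)
    assume ns: "\<not> surj C'"
    have "linear C'" using derC by (rule has_derivative_linear)
    then have "span (range C') = range C'"
      by (simp add: linear_subspace_image span_eq_iff)
    then have "dim (range C') < DIM('a)"
      using ns dim_eq_full[of "range C'"] dim_subset_UNIV[of "range C'"] by fastforce
    then obtain \<eta> where "\<eta> \<noteq> 0" and "\<And>y. y \<in> span (range C') \<Longrightarrow> orthogonal \<eta> y"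
      by (rule orthogonal_to_subspace_exists) auto
    then have \<eta>: "\<eta> \<bullet> C' d = 0" for d
      by (simp add: orthogonal_def span_base)
    \<comment> \<open>The direction \<open>(0, \<eta>)\<close> shows that
      \<open>P \<eta> = 0\<close>, so \<open>\<eta>\<close> lies in \<open>E\<close>. The directions
      \<open>(d, 0)\<close> and independence show that \<open>\<eta>\<close> is orthogonal to every
      \<open>a i\<close>, hence to itself.\<close>
    have "(\<Sum>v\<in>B. (v \<bullet> \<eta>) *\<^sub>R v) \<bullet> P \<eta> = 0"
      by (simp add: inner_sum_left P_orth_B)
    then have "P \<eta> \<bullet> P \<eta> = \<eta> \<bullet> P \<eta>"
      by (subst (1) P_def) (simp only: inner_diff_left diff_0_right)
    also have "\<dots> = 0" using \<eta>[of "(0, \<eta>)"] by (simp add: C'_def)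
    finally have "P \<eta> = 0" by simp
    then have "\<eta> = (\<Sum>v\<in>B. (v \<bullet> \<eta>) *\<^sub>R v)" by (simp add: P_def)
    then have \<eta>E: "\<eta> \<in> span (a ` {1..l})"
      using B(6) unfolding E_def by (metis (no_types, lifting) span_base span_scale span_sum)
    have "(\<Sum>i=1..l. (\<eta> \<bullet> a i) *\<^sub>R a i) \<bullet> d = 0" for d
      using \<eta>[of "(d, 0)"] linear_0[OF bounded_linear.linear[OF P_bl]]
      by (simp add: C'_def inner_sum_left inner_sum_right mult.commute inner_commute)
    then have "(\<Sum>i=1..l. (\<eta> \<bullet> a i) *\<^sub>R a i) = 0" using inner_eq_zero_iff by blast
    then have "\<eta> \<bullet> a i = 0" if "i \<in> {1..l}" for i
      using indep[of "\<lambda>i. \<eta> \<bullet> a i"] that by simp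
    then have "orthogonal \<eta> \<eta>"
      by (intro orthogonal_to_span[OF \<eta>E]) (auto simp: orthogonal_def)
    with \<open>\<eta> \<noteq> 0\<close> show False by (simp add: orthogonal_def)
  qed
  obtain \<eta> where \<eta>: "fst d \<bullet> g = \<eta> \<bullet> C' d" for d
  proof (rule lagrange_multiplier_surjective[where h = "\<lambda>z. h (fst z)" and c = C
        and x = "(x, 0)" and h' = "\<lambda>d. fst d \<bullet> g" and c' = C'])
    show "continuous_on UNIV (\<lambda>z::'a \<times> 'a. h (fst z))"
      by (rule continuous_on_compose2[OF h(1) continuous_on_fst[OF continuous_on_id]]) auto
    have "(h has_derivative (\<lambda>d. d \<bullet> g)) (at (fst (x, 0::'a)))"
      using h(2) by (simp add: gderiv_def)
    from has_derivative_compose[OF has_derivative_fst[OF has_derivative_ident] this]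
    show "((\<lambda>z. h (fst z)) has_derivative (\<lambda>d. fst d \<bullet> g)) (at (x, 0::'a))" .
    have "continuous_on UNIV (\<lambda>z::'a \<times> 'a. c i (fst z))" if "i \<in> {1..l}" for i
      by (rule continuous_on_compose2[OF c(1)[OF that] continuous_on_fst[OF continuous_on_id]]) auto
    moreover have "continuous_on UNIV (\<lambda>z::'a \<times> 'a. P (snd z))"
      by (rule continuous_on_compose2[OF linear_continuous_on[OF P_bl, of UNIV]
            continuous_on_snd[OF continuous_on_id]]) auto
    ultimately show "continuous_on UNIV C"
      unfolding C_def by (intro continuous_intros) auto
    show "(C has_derivative C') (at (x, 0))" "surj C'" "e > 0" by fact+
    show "h (fst (x, 0::'a)) \<le> h (fst z)" if "C z = C (x, 0)" "dist z (x, 0) < e" for z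
    proof -
      have "C (x, 0) = 0"
        using linear_0[OF bounded_linear.linear[OF P_bl]] by (simp add: C_def)
      moreover have "dist (fst z) x \<le> dist z (x, 0)"
        using dist_fst_le[of z "(x, 0)"] by simp
      ultimately show ?thesis
        using that min[of "fst z"] C0[of z] by simp
    qed
  qed blast
  \<comment> \<open>Restricting the identity to directions \<open>(d, 0)\<close> removes the
    auxiliary variable and exhibits the multipliers.\<close>
  have "(g + (\<Sum>i=1..l. (- (\<eta> \<bullet> a i)) *\<^sub>R a i)) \<bullet> d = 0" for d
    using \<eta>[of "(d, 0)"] linear_0[OF bounded_linear.linear[OF P_bl]]
    by (simp add: C'_def inner_commute[of _ d] inner_add_right inner_diff_right inner_sum_right
        sum_negf mult.commute)
  then have "g + (\<Sum>i=1..l. (- (\<eta> \<bullet> a i)) *\<^sub>R a i) = 0"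
    using inner_eq_zero_iff by blast
  then show thesis by (rule that)
qed

text \<open>Induction on \<open>l\<close>: the multipliers for the kernel of the last form are kept,
  and one multiple of \<open>a (Suc l)\<close> corrects the value on a vector outside that kernel.
  Dependent \<open>a i\<close> are allowed, so the multipliers need not be unique.\<close>

lemma linear_multipliers_on_subspace:
  fixes g :: "'a::real_inner" and a :: "nat \<Rightarrow> 'a"
  assumes "subspace S"
    and "\<And>D. D \<in> S \<Longrightarrow> (\<forall>i\<in>{1..l}. a i \<bullet> D = 0) \<Longrightarrow> g \<bullet> D = 0"
  shows "\<exists>y. \<forall>D\<in>S. (g + (\<Sum>i=1..l. y i *\<^sub>R a i)) \<bullet> D = 0"
  using assms
proof (induction l arbitrary: S)
  case 0
  then show ?case by simp
next
  case (Suc l)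
  have set_Suc: "{1..Suc l} = insert (Suc l) {1..l}" by auto
  define S' where "S' = {D\<in>S. a (Suc l) \<bullet> D = 0}"
  have "subspace S'"
    using Suc.prems(1) unfolding S'_def subspace_def by (simp add: inner_add_right)
  moreover have "g \<bullet> D = 0" if "D \<in> S'" "\<forall>i\<in>{1..l}. a i \<bullet> D = 0" for D
    using that Suc.prems(2)[of D] unfolding S'_def set_Suc by auto
  ultimately obtain y where y: "\<forall>D\<in>S'. (g + (\<Sum>i=1..l. y i *\<^sub>R a i)) \<bullet> D = 0"
    using Suc.IH by blast
  define G where "G = g + (\<Sum>i=1..l. y i *\<^sub>R a i)"
  have "\<exists>t. \<forall>D\<in>S. (G + t *\<^sub>R a (Suc l)) \<bullet> D = 0"
  proof (cases "\<forall>D\<in>S. a (Suc l) \<bullet> D = 0")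
    case True
    then show ?thesis using y by (intro exI[of _ 0]) (auto simp: S'_def G_def)
  next
    case False
    then obtain D0 where D0: "D0 \<in> S" "a (Suc l) \<bullet> D0 \<noteq> 0" by auto
    define k where "k = a (Suc l) \<bullet> D0"
    have "(G + (- (G \<bullet> D0) / k) *\<^sub>R a (Suc l)) \<bullet> D = 0" if "D \<in> S" for D
    proof -
      \<comment> \<open>Removing a multiple of \<open>D0\<close> leads into \<open>S'\<close>; the
        multiplier of \<open>a (Suc l)\<close> is chosen so that the new form vanishes on
        \<open>D0\<close>.\<close>
      have "D - ((a (Suc l) \<bullet> D) / k) *\<^sub>R D0 \<in> S'"
        using that D0 Suc.prems(1) unfolding S'_def k_def
        by (auto simp: inner_diff_right subspace_diff subspace_scale)
      then have "G \<bullet> (D - ((a (Suc l) \<bullet> D) / k) *\<^sub>R D0) = 0"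
        using y by (simp add: G_def)
      then show ?thesis by (simp add: inner_diff_right inner_diff_left mult.commute)
    qed
    then show ?thesis by blast
  qed
  then obtain t where t: "\<forall>D\<in>S. (G + t *\<^sub>R a (Suc l)) \<bullet> D = 0" by blast
  have "(\<Sum>i=1..l. (y(Suc l := t)) i *\<^sub>R a i) = (\<Sum>i=1..l. y i *\<^sub>R a i)"
    by (rule sum.cong) auto
  then have "g + (\<Sum>i=1..Suc l. (y(Suc l := t)) i *\<^sub>R a i) = G + t *\<^sub>R a (Suc l)"
    by (simp add: G_def)
  with t show ?case by metis
qed

section \<open>Derivatives along lines, independent families and tangent cones\<close>

lemma gderiv_line:
  assumes "GDERIV f X :> g"
  shows "((\<lambda>t. f (X + t *\<^sub>R D)) has_real_derivative g \<bullet> D) (at 0)"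
proof -
  have "((\<lambda>t. X + t *\<^sub>R D) has_derivative (\<lambda>t. t *\<^sub>R D)) (at 0)"
    by (auto intro!: derivative_eq_intros)
  moreover have "(f has_derivative (\<lambda>h. h \<bullet> g)) (at (X + 0 *\<^sub>R D))"
    using assms by (simp add: gderiv_def)
  ultimately have "((\<lambda>t. f (X + t *\<^sub>R D)) has_derivative (\<lambda>t. (t *\<^sub>R D) \<bullet> g)) (at 0)"
    by (rule has_derivative_compose)
  then show ?thesis
    by (rule has_derivative_imp_has_field_derivative) (simp add: inner_commute)
qed

text \<open>On a line inside \<open>S\<close> the point is a local minimum of a function of one
  variable, so Fermat's rule applies.\<close>

lemma local_minimizer_gradient_line:
  fixes f :: "'a::real_inner \<Rightarrow> real"
  assumes "local_minimizer_on f S X" "GDERIV f X :> g" "\<And>t. X + t *\<^sub>R D \<in> S"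
  shows "g \<bullet> D = 0"
proof -
  obtain e where e: "e > 0" "\<And>Y. Y \<in> S \<Longrightarrow> dist Y X < e \<Longrightarrow> f X \<le> f Y"
    using assms(1) unfolding local_minimizer_on_def by auto
  show ?thesis
  proof (rule DERIV_local_min[OF gderiv_line[OF assms(2)]])
    \<comment> \<open>The summand 1 keeps the radius meaningful when \<open>D = 0\<close>.\<close>
    show "0 < e / (norm D + 1)" using e by (simp add: add_nonneg_pos)
    show "\<forall>t. \<bar>0 - t\<bar> < e / (norm D + 1) \<longrightarrow> f (X + 0 *\<^sub>R D) \<le> f (X + t *\<^sub>R D)"
    proof (intro allI impI)
      fix t :: real assume "\<bar>0 - t\<bar> < e / (norm D + 1)"
      then have "\<bar>t\<bar> * (norm D + 1) < e"
        by (simp add: pos_less_divide_eq add_nonneg_pos)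
      moreover have "\<bar>t\<bar> * norm D \<le> \<bar>t\<bar> * (norm D + 1)"
        by (simp add: mult_left_mono)
      ultimately show "f (X + 0 *\<^sub>R D) \<le> f (X + t *\<^sub>R D)"
        using e(2)[of "X + t *\<^sub>R D"] assms(3) by (simp add: dist_norm)
    qed
  qed
qed

text \<open>Injectivity turns coefficients indexed by numbers into coefficients indexed by the
  vectors themselves, the form in which \<open>independent\<close> can be used.\<close>

lemma independent_family_sum_eq_0:
  assumes "independent_family l B" "(\<Sum>i=1..l. u i *\<^sub>R B i) = 0" "i \<in> {1..l}"
  shows "u i = 0"
proof -
  have inj: "inj_on B {1..l}" and ind: "independent (B ` {1..l})"
    using assms(1) by (auto simp: independent_family_def)
  define v where "v x = u (the_inv_into {1..l} B x)" for x
  have v: "v (B j) = u j" if "j \<in> {1..l}" for j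
    using inj that by (simp add: v_def the_inv_into_f_f)
  have "(\<Sum>x\<in>B ` {1..l}. v x *\<^sub>R x) = (\<Sum>i=1..l. u i *\<^sub>R B i)"
    using inj v by (simp add: sum.reindex)
  with assms(2) have "(\<Sum>x\<in>B ` {1..l}. v x *\<^sub>R x) = 0" by simp
  then have "v (B i) = 0"
    using independentD[OF ind, of "B ` {1..l}" v "B i"] assms(3) by auto
  then show ?thesis using v assms(3) by simp
qed

text \<open>Along a line the difference quotients are constantly \<open>D\<close>.\<close>

lemma line_in_bouligand_tangent_cone:
  assumes "\<And>t. X + t *\<^sub>R D \<in> \<Omega>"
  shows "D \<in> bouligand_tangent_cone \<Omega> X"
proof -
  define t where "t k = inverse (real (Suc k))" for k
  have t: "t \<longlonglongrightarrow> 0" unfolding t_def by (rule LIMSEQ_inverse_real_of_nat)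
  have "(\<lambda>k. X + t k *\<^sub>R D) \<longlonglongrightarrow> X + 0 *\<^sub>R D" by (intro tendsto_intros t)
  moreover have pos: "t k > 0" for k by (simp add: t_def)
  moreover have "(\<lambda>k. inverse (t k) *\<^sub>R ((X + t k *\<^sub>R D) - X)) = (\<lambda>k. D)"
    using pos by (auto simp: fun_eq_iff less_imp_neq[symmetric])
  ultimately show ?thesis
    unfolding bouligand_tangent_cone_def using assms t
    by (intro CollectI exI[of _ "\<lambda>k. X + t k *\<^sub>R D"] exI[of _ t]) auto
qed

text \<open>The difference quotients all lie in the closed subspace orthogonal to \<open>E\<close>,
  hence so does their limit.\<close>

lemma bouligand_tangent_cone_orthogonal:
  fixes X :: "'a::real_inner"
  assumes "\<Xi> \<in> bouligand_tangent_cone \<Omega> X" "\<And>Y. Y \<in> \<Omega> \<Longrightarrow> E \<bullet> (Y - X) = 0"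
  shows "E \<bullet> \<Xi> = 0"
proof -
  obtain Xs :: "nat \<Rightarrow> 'a" and t :: "nat \<Rightarrow> real" where "\<And>k. Xs k \<in> \<Omega>"
      and lim: "(\<lambda>k. inverse (t k) *\<^sub>R (Xs k - X)) \<longlonglongrightarrow> \<Xi>"
    using assms(1) by (auto simp: bouligand_tangent_cone_def)
  then have "(\<lambda>k. E \<bullet> (inverse (t k) *\<^sub>R (Xs k - X))) = (\<lambda>k. 0)"
    using assms(2) by simp
  moreover have "(\<lambda>k. E \<bullet> (inverse (t k) *\<^sub>R (Xs k - X))) \<longlonglongrightarrow> E \<bullet> \<Xi>"
    by (intro tendsto_intros lim)
  ultimately show ?thesis by (metis LIMSEQ_unique tendsto_const)
qed

section \<open>Matrix products, rank-one matrices and bounded rank\<close>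

lemma bounded_bilinear_matrix_matrix_mult:
  "bounded_bilinear ((**) :: real^'n^'m \<Rightarrow> real^'p^'n \<Rightarrow> real^'p^'m)"
  unfolding bilinear_conv_bounded_bilinear[symmetric] bilinear_def
  by (auto intro!: linearI simp: vec_eq_iff matrix_matrix_mult_def sum.distrib sum_distrib_left
      algebra_simps)

lemma bounded_bilinear_matrix_vector_mult:
  "bounded_bilinear ((*v) :: real^'n^'m \<Rightarrow> real^'n \<Rightarrow> real^'m)"
  unfolding bilinear_conv_bounded_bilinear[symmetric] bilinear_def
  by (auto intro!: linearI simp: vec_eq_iff matrix_vector_mult_def sum.distrib sum_distrib_left
      algebra_simps)

lemma inner_matrix_mult_left:
  fixes A :: "real^'n^'m" and B :: "real^'p^'n"
  shows "(A ** B) \<bullet> C = B \<bullet> (transpose A ** C)"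
proof -
  have "(A ** B) \<bullet> C = (\<Sum>i\<in>UNIV. \<Sum>j\<in>UNIV. \<Sum>k\<in>UNIV. A$i$k * B$k$j * C$i$j)"
    by (simp add: inner_vec_def matrix_matrix_mult_def sum_distrib_right)
  also have "\<dots> = (\<Sum>i\<in>UNIV. \<Sum>k\<in>UNIV. \<Sum>j\<in>UNIV. A$i$k * B$k$j * C$i$j)"
    by (intro sum.cong refl sum.swap)
  also have "\<dots> = (\<Sum>k\<in>UNIV. \<Sum>i\<in>UNIV. \<Sum>j\<in>UNIV. A$i$k * B$k$j * C$i$j)"
    by (rule sum.swap)
  also have "\<dots> = (\<Sum>k\<in>UNIV. \<Sum>j\<in>UNIV. \<Sum>i\<in>UNIV. A$i$k * B$k$j * C$i$j)"
    by (intro sum.cong refl sum.swap)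
  also have "\<dots> = B \<bullet> (transpose A ** C)"
    by (simp add: inner_vec_def matrix_matrix_mult_def transpose_def sum_distrib_left ac_simps)
  finally show ?thesis .
qed

lemma inner_transpose: "transpose A \<bullet> transpose B = A \<bullet> (B :: real^'n^'m)"
  unfolding inner_vec_def transpose_def by (simp, rule sum.swap)

lemma inner_matrix_mult_right:
  fixes A :: "real^'n^'m" and B :: "real^'p^'n"
  shows "(A ** B) \<bullet> C = A \<bullet> (C ** transpose B)"
  using inner_matrix_mult_left[of "transpose B" "transpose A" "transpose C"]
  by (metis inner_transpose matrix_transpose_mul transpose_transpose)

definition outer_prod :: "real^'m \<Rightarrow> real^'n \<Rightarrow> real^'n^'m" where
  "outer_prod u v = (\<chi> i j. u $ i * v $ j)"

lemma inner_outer_prod: "M \<bullet> outer_prod u v = u \<bullet> (M *v v)"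
  by (simp add: inner_vec_def outer_prod_def matrix_vector_mult_def sum_distrib_left ac_simps)

lemma outer_prod_mult_vec: "outer_prod u v *v w = (v \<bullet> w) *\<^sub>R u"
  by (simp add: vec_eq_iff inner_vec_def outer_prod_def matrix_vector_mult_def sum_distrib_left
      ac_simps)

text \<open>Every value of the new matrix is a value of \<open>X\<close> plus a multiple of
  \<open>u\<close>, so the range gains at most one dimension.\<close>

lemma rank_add_outer_prod:
  "rank (X + t *\<^sub>R outer_prod u v) \<le> rank X + 1"
proof -
  have "(X + t *\<^sub>R outer_prod u v) *v w = X *v w + (t * (v \<bullet> w)) *\<^sub>R u" for w
    by (simp add: matrix_vector_mult_add_rdistrib scaleR_matrix_vector_assoc[symmetric]
        outer_prod_mult_vec)
  then have "range ((*v) (X + t *\<^sub>R outer_prod u v)) \<subseteq> span (insert u (range ((*v) X)))"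
    by (auto intro!: span_add span_scale intro: span_base)
  then have "dim (range ((*v) (X + t *\<^sub>R outer_prod u v))) \<le> dim (insert u (range ((*v) X)))"
    by (rule dim_mono)
  then show ?thesis
    using dim_insert[of u "range ((*v) X)"] by (auto simp: rank_dim_range split: if_splits)
qed

lemma rank_le_card_nonzero_columns:
  fixes N :: "real^'n^'m"
  assumes "\<And>q. q \<notin> J \<Longrightarrow> column q N = 0"
  shows "rank N \<le> card J"
proof -
  have "columns N \<subseteq> span ((\<lambda>q. column q N) ` J)"
  proof
    fix x assume "x \<in> columns N"
    then obtain q where "x = column q N" by (auto simp: columns_def)
    then show "x \<in> span ((\<lambda>q. column q N) ` J)"
      using assms by (cases "q \<in> J") (auto intro: span_base simp: span_zero)
  qed
  then have "dim (columns N) \<le> card ((\<lambda>q. column q N) ` J)"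
    by (rule dim_le_card) simp
  then show ?thesis
    using card_image_le[of J "\<lambda>q. column q N"] by (simp add: column_rank_def)
qed

text \<open>
  For \<open>Y\<close> close to \<open>X\<close> of the same rank, \<open>v\<close> in the kernel of \<open>X\<close> is corrected by a small \<open>z\<close>
  in the row space of \<open>X\<close> to an element \<open>v - z\<close> of the kernel of \<open>Y\<close>, and \<open>u\<close> annihilates the
  difference \<open>Y - X\<close> on that element.
\<close>

lemma tangent_rank_le_kernel:
  fixes X :: "real^'n^'m"
  assumes \<Xi>: "\<Xi> \<in> bouligand_tangent_cone (rank_le (rank X)) X"
    and v: "X *v v = 0" and u: "transpose X *v u = 0"
  shows "u \<bullet> (\<Xi> *v v) = 0"
proof -
  obtain K where K: "K > 0" "\<And>(M::real^'n^'m) w. norm (M *v w) \<le> norm M * norm w * K"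
    using bounded_bilinear.pos_bounded[OF bounded_bilinear_matrix_vector_mult] by auto
  obtain Xs :: "nat \<Rightarrow> real^'n^'m" and t :: "nat \<Rightarrow> real"
    where Xs: "\<And>k. rank (Xs k) \<le> rank X" "Xs \<longlonglongrightarrow> X"
      and lim: "(\<lambda>k. inverse (t k) *\<^sub>R (Xs k - X)) \<longlonglongrightarrow> \<Xi>"
    using \<Xi> by (auto simp: bouligand_tangent_cone_def rank_le_def)
  define Q where "Q k = inverse (t k) *\<^sub>R (Xs k - X)" for k
  define R where "R = span (rows X)"
  \<comment> \<open>\<open>X\<close> is injective on its row space, so it is bounded below
    there.\<close>
  have "\<exists>e>0. \<forall>x\<in>R. norm (X *v x) \<ge> e * norm x"
    using nullspace_inter_rowspace[of X] unfolding R_def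
    by (intro injective_imp_isometric closed_span subspace_span) auto
  then obtain e where e: "e > 0" "\<And>x. x \<in> R \<Longrightarrow> norm (X *v x) \<ge> e * norm x" by blast
  have uX: "u \<bullet> (X *v w) = 0" for w
    using u by (metis dot_lmul_matrix inner_zero_left transpose_matrix_vector)
  have "(\<lambda>k. norm (Xs k - X)) \<longlonglongrightarrow> 0"
    using Xs(2) by (simp add: LIM_zero tendsto_norm_zero)
  \<comment> \<open>Within this radius the perturbation costs at most half of the lower bound
    \<open>e\<close>, so \<open>Xs k\<close> is still injective on \<open>R\<close>.\<close>
  then have "\<forall>\<^sub>F k in sequentially. norm (Xs k - X) < e / (2 * K)"
    using e K by (intro order_tendstoD(2)) auto
  then have "\<forall>\<^sub>F k in sequentially.
      norm (u \<bullet> (Q k *v v)) \<le> norm u * (norm (Q k) * (2 / e * norm (Xs k *v v)) * K)"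
  proof eventually_elim
    case (elim k)
    have lower: "e / 2 * norm x \<le> norm (Xs k *v x)" if "x \<in> R" for x
    proof -
      have "norm ((Xs k - X) *v x) \<le> norm (Xs k - X) * norm x * K" by (rule K)
      also have "\<dots> = (norm (Xs k - X) * K) * norm x" by simp
      also have "\<dots> \<le> e / 2 * norm x"
        using elim K(1) by (intro mult_right_mono) (auto simp: field_simps)
      finally have "norm ((Xs k - X) *v x) \<le> e / 2 * norm x" .
      moreover have "norm (X *v x) \<le> norm (Xs k *v x) + norm ((Xs k - X) *v x)"
        using norm_triangle_ineq4[of "Xs k *v x" "(Xs k - X) *v x"] by (simp add: matrix_vector_mult_diff_rdistrib)
      ultimately show ?thesis using e(2)[OF that] by (simp add: field_simps)
    qed
    have "inj_on ((*v) (Xs k)) (span R)"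
    proof (rule inj_onI)
      fix x y assume "x \<in> span R" "y \<in> span R" "Xs k *v x = Xs k *v y"
      then have "x - y \<in> R" "Xs k *v (x - y) = 0"
        by (auto simp: R_def span_span span_diff matrix_vector_mult_diff_distrib)
      then show "x = y" using lower[of "x - y"] e(1)
        by (simp add: mult_le_0_iff)
    qed
    then have "dim ((*v) (Xs k) ` R) = rank X"
      by (simp add: dim_image_eq row_rank_def R_def)
    then have "(*v) (Xs k) ` R = range ((*v) (Xs k))"
      using Xs(1)[of k] unfolding R_def
      by (intro subspace_dim_equal linear_subspace_image) (auto simp: rank_dim_range)
    \<comment> \<open>The image of \<open>R\<close> is the whole range of \<open>Xs k\<close>,
      because it has dimension \<open>rank X\<close> and the rank of \<open>Xs k\<close> is no
      larger. So the value at \<open>v\<close> is also attained at some \<open>z\<close> in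
      \<open>R\<close>.\<close>
    then obtain z where z: "z \<in> R" "Xs k *v v = Xs k *v z" by blast
    have "u \<bullet> ((Xs k - X) *v (v - z)) = 0"
      using z uX by (simp add: matrix_vector_mult_diff_rdistrib matrix_vector_mult_diff_distrib inner_diff_right)
    then have "u \<bullet> (Q k *v v) = u \<bullet> (Q k *v z)"
      unfolding Q_def by (simp add: scaleR_matrix_vector_assoc[symmetric] matrix_vector_mult_diff_distrib inner_diff_right)
    moreover have "norm z \<le> 2 / e * norm (Xs k *v v)"
      using lower[OF z(1)] z(2) e(1) by (simp add: field_simps)
    then have "norm (Q k *v z) \<le> norm (Q k) * (2 / e * norm (Xs k *v v)) * K"
      using K by (intro order.trans[OF K(2)] mult_right_mono mult_left_mono) auto
    then have "norm u * norm (Q k *v z) \<le> norm u * (norm (Q k) * (2 / e * norm (Xs k *v v)) * K)"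
      by (rule mult_left_mono) simp
    ultimately show ?case
      using Cauchy_Schwarz_ineq2[of u "Q k *v z"] by simp
  qed
  \<comment> \<open>The bound tends to 0 because the factor \<open>norm (Xs k *v v)\<close> tends to
    \<open>norm (X *v v)\<close>, and \<open>v\<close> is in the kernel of \<open>X\<close>.\<close>
  moreover have "(\<lambda>k. norm u * (norm (Q k) * (2 / e * norm (Xs k *v v)) * K)) \<longlonglongrightarrow>
      norm u * (norm \<Xi> * (2 / e * norm (X *v v)) * K)"
    using lim unfolding Q_def by (intro tendsto_intros bounded_bilinear.tendsto[OF bounded_bilinear_matrix_vector_mult] Xs(2))
  then have "(\<lambda>k. norm u * (norm (Q k) * (2 / e * norm (Xs k *v v)) * K)) \<longlonglongrightarrow> 0"
    by (simp only: v norm_zero mult_zero_left mult_zero_right)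
  ultimately have "(\<lambda>k. u \<bullet> (Q k *v v)) \<longlonglongrightarrow> 0"
    by (rule Lim_null_comparison)
  moreover have "(\<lambda>k. u \<bullet> (Q k *v v)) \<longlonglongrightarrow> u \<bullet> (\<Xi> *v v)"
    using lim unfolding Q_def by (intro tendsto_intros bounded_bilinear.tendsto[OF bounded_bilinear_matrix_vector_mult])
  ultimately show ?thesis by (metis LIMSEQ_unique)
qed

section \<open>Gradients of pulled back functions and of the Lagrangian\<close>

text \<open>The product rule at the identity pair gives the derivative
  \<open>X ** snd d + fst d ** X\<close>; taking adjoints of the two multiplications by
  \<open>X\<close> produces the two components.\<close>

lemma gderiv_mult_both_sides:
  fixes X :: "real^'n^'m" and F :: "real^'n^'m \<Rightarrow> real"
  assumes "GDERIV F X :> g"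
  shows "GDERIV (\<lambda>z. F (fst z ** X ** snd z)) (mat 1, mat 1) :> (g ** transpose X, transpose X ** g)"
proof -
  have "((\<lambda>z. fst z ** X) has_derivative (\<lambda>d. fst d ** X)) (at (mat 1, mat 1 :: real^'n^'n))"
    by (intro bounded_linear_imp_has_derivative
        bounded_bilinear.bounded_linear_left[OF bounded_bilinear_matrix_matrix_mult, THEN bounded_linear_compose]
        bounded_linear_fst)
  from bounded_bilinear.FDERIV[OF bounded_bilinear_matrix_matrix_mult this
      has_derivative_snd[OF has_derivative_ident]]
  have "((\<lambda>z. fst z ** X ** snd z) has_derivative (\<lambda>d. X ** snd d + fst d ** X)) (at (mat 1, mat 1))"
    by simp
  moreover have "(F has_derivative (\<lambda>h. h \<bullet> g)) (at (fst (mat 1, mat 1) ** X ** snd (mat 1, mat 1)))"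
    using assms by (simp add: gderiv_def)
  ultimately have "((\<lambda>z. F (fst z ** X ** snd z)) has_derivative (\<lambda>d. (X ** snd d + fst d ** X) \<bullet> g))
      (at (mat 1, mat 1))"
    by (rule has_derivative_compose)
  moreover have "(X ** snd d + fst d ** X) \<bullet> g = d \<bullet> (g ** transpose X, transpose X ** g)" for d
    unfolding inner_add_left inner_matrix_mult_left[of X] inner_matrix_mult_right[of "fst d"]
    by (simp add: inner_prod_def)
  ultimately show ?thesis by (simp add: gderiv_def)
qed

text \<open>By linearity, a multiplier identity for the pulled back problem becomes two equations
  for the gradient of the original Lagrangian.\<close>

lemma gradient_family_sum:
  fixes g :: "real^'n^'m" and A :: "nat \<Rightarrow> real^'n^'m" and X :: "real^'n^'m"
  shows "(g ** transpose X, transpose X ** g)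
      + (\<Sum>i=1..l. y i *\<^sub>R (A i ** transpose X, transpose X ** A i))
    = ((g + (\<Sum>i=1..l. y i *\<^sub>R A i)) ** transpose X, transpose X ** (g + (\<Sum>i=1..l. y i *\<^sub>R A i)))"
  by (simp add: prod_eq_iff fst_sum snd_sum
      bounded_bilinear.add_left[OF bounded_bilinear_matrix_matrix_mult]
      bounded_bilinear.add_right[OF bounded_bilinear_matrix_matrix_mult]
      bounded_bilinear.sum_left[OF bounded_bilinear_matrix_matrix_mult]
      bounded_bilinear.sum_right[OF bounded_bilinear_matrix_matrix_mult]
      bounded_bilinear.scaleR_left[OF bounded_bilinear_matrix_matrix_mult]
      bounded_bilinear.scaleR_right[OF bounded_bilinear_matrix_matrix_mult])

lemma gderiv_lagrangian:
  assumes "GDERIV f X :> g"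
  shows "GDERIV (\<lambda>Z. lagrangian f l A b Z y) X :> g + (\<Sum>i=1..l. y i *\<^sub>R A i)"
proof -
  have "((\<lambda>Z. \<Sum>i=1..l. y i * (A i \<bullet> Z - b i)) has_derivative
      (\<lambda>h. \<Sum>i=1..l. y i * (A i \<bullet> h))) (at X)"
    by (auto intro!: derivative_eq_intros)
  from has_derivative_add[OF assms[unfolded gderiv_def] this]
  show ?thesis
    by (simp add: gderiv_def lagrangian_def inner_add_right inner_sum_right inner_commute)
qed

lemma matrix_vector_mult_column:
  fixes A :: "real^'n^'m" and B :: "real^'p^'n"
  shows "A *v column q B = column q (A ** B)"
  by (simp add: matrix_matrix_mult_def matrix_vector_mult_def column_def vec_eq_iff)

section \<open>Coordinates given by a singular value decomposition\<close>

locale svd =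
  fixes \<iota> :: "'n::finite \<Rightarrow> 'm::finite" and X :: "real^'n^'m"
    and U :: "real^'m^'m" and \<sigma> :: "real^'n" and V :: "real^'n^'n"
  assumes is_svd: "is_svd \<iota> X U \<sigma> V"
begin

abbreviation coord :: "real^'n^'m \<Rightarrow> real^'n^'m" where
  "coord M \<equiv> transpose U ** M ** V"

abbreviation \<Gamma> :: "'n set" where
  "\<Gamma> \<equiv> nonzero_sv \<sigma>"

text \<open>These matrices form an orthonormal basis of the matrix space, and \<open>coord M\<close>
  is the table of coordinates of \<open>M\<close> in it.\<close>

definition unit :: "'m \<Rightarrow> 'n \<Rightarrow> real^'n^'m" where
  "unit p q = outer_prod (column p U) (column q V)"

lemma inj_iota: "inj \<iota>"
  and U: "transpose U ** U = mat 1" "U ** transpose U = mat 1"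
  and V: "transpose V ** V = mat 1" "V ** transpose V = mat 1"
  and X_eq: "X = U ** rect_diag \<iota> \<sigma> ** transpose V"
  using is_svd by (auto simp: is_svd_def orthogonal_matrix_def)

lemma X_mult_column: "X *v column q V = \<sigma> $ q *\<^sub>R column (\<iota> q) U"
proof -
  have "X *v column q V = column q (X ** V)"
    by (rule matrix_vector_mult_column)
  also have "X ** V = U ** rect_diag \<iota> \<sigma>"
    unfolding X_eq by (simp add: V flip: matrix_mul_assoc)
  also have "column q (U ** rect_diag \<iota> \<sigma>) = U *v column q (rect_diag \<iota> \<sigma>)"
    by (rule matrix_vector_mult_column[symmetric])
  also have "column q (rect_diag \<iota> \<sigma>) = \<sigma> $ q *\<^sub>R axis (\<iota> q) 1"
    by (simp add: vec_eq_iff column_def rect_diag_def axis_def)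
  finally show ?thesis
    by (simp add: matrix_vector_mult_basis matrix_vector_mult_scaleR)
qed

text \<open>The vector on the right is zero when \<open>p\<close> is outside the range of
  \<open>\<iota>\<close>, and a multiple of a standard basis vector otherwise. One formula thus
  covers the surplus rows of a rectangular matrix.\<close>

lemma transpose_X_mult_column:
  "transpose X *v column p U = V *v (\<chi> q. if p = \<iota> q then \<sigma> $ q else 0)"
proof -
  have "transpose X *v column p U = column p (transpose X ** U)"
    by (rule matrix_vector_mult_column)
  also have "transpose X ** U = V ** transpose (rect_diag \<iota> \<sigma>)"
    unfolding X_eq by (simp add: U matrix_transpose_mul flip: matrix_mul_assoc)
  also have "column p (V ** transpose (rect_diag \<iota> \<sigma>)) = V *v column p (transpose (rect_diag \<iota> \<sigma>))"
    by (rule matrix_vector_mult_column[symmetric])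
  also have "column p (transpose (rect_diag \<iota> \<sigma>)) = (\<chi> q. if p = \<iota> q then \<sigma> $ q else 0)"
    by (simp add: vec_eq_iff column_def rect_diag_def transpose_def)
  finally show ?thesis .
qed

lemma transpose_X_mult_column_image:
  "transpose X *v column (\<iota> q) U = \<sigma> $ q *\<^sub>R column q V"
proof -
  have "(\<chi> q'. if \<iota> q = \<iota> q' then \<sigma> $ q' else 0) = \<sigma> $ q *\<^sub>R axis q 1"
    using inj_iota by (auto simp: vec_eq_iff axis_def inj_eq)
  then show ?thesis
    by (simp only: transpose_X_mult_column matrix_vector_mult_basis matrix_vector_mult_scaleR)
qed

lemma transpose_X_mult_column_eq_0:
  assumes "p \<notin> \<iota> ` \<Gamma>"
  shows "transpose X *v column p U = 0"
proof -
  have "(\<chi> q. if p = \<iota> q then \<sigma> $ q else 0) = 0"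
    using assms by (auto simp: vec_eq_iff nonzero_sv_def)
  then show ?thesis by (simp only: transpose_X_mult_column matrix_vector_mult_0_right)
qed

lemma X_mult_column_eq_0: "q \<notin> \<Gamma> \<Longrightarrow> X *v column q V = 0"
  by (simp add: X_mult_column nonzero_sv_def)

lemma inner_coord: "coord M \<bullet> coord N = M \<bullet> N"
proof -
  have "coord M \<bullet> coord N = M \<bullet> ((U ** transpose U) ** N ** (V ** transpose V))"
    by (simp add: inner_matrix_mult_right[of _ V] inner_matrix_mult_left[of "transpose U"] matrix_mul_assoc)
  then show ?thesis by (simp add: U V)
qed

lemma coord_nth: "coord M $ p $ q = M \<bullet> unit p q"
proof -
  have "coord M $ p $ q = (transpose U ** (M ** V)) $ p $ q"
    by (simp only: matrix_mul_assoc)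
  also have "\<dots> = column p U \<bullet> column q (M ** V)"
    by (simp add: matrix_matrix_mult_def transpose_def column_def inner_vec_def)
  also have "column q (M ** V) = M *v column q V"
    by (rule matrix_vector_mult_column[symmetric])
  finally show ?thesis by (simp add: unit_def inner_outer_prod)
qed

lemma inner_eq_sum_unit:
  "M \<bullet> N = (\<Sum>p\<in>UNIV. \<Sum>q\<in>UNIV. (M \<bullet> unit p q) * (N \<bullet> unit p q))"
proof -
  have "M \<bullet> N = (\<Sum>p\<in>UNIV. \<Sum>q\<in>UNIV. coord M $ p $ q * coord N $ p $ q)"
    unfolding inner_coord[of M N, symmetric] by (simp add: inner_vec_def)
  then show ?thesis by (simp only: coord_nth)
qed

lemma eq_0_if_unit: "(\<And>p q. M \<bullet> unit p q = 0) \<Longrightarrow> M = 0"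
  using inner_eq_sum_unit[of M M] by simp

lemma column_U_inner: "column p U \<bullet> column p' U = (if p = p' then 1 else 0)"
  using U(1) unfolding vec_eq_iff by (simp add: matrix_mult_transpose_dot_column mat_def)

lemma column_V_inner: "column q V \<bullet> column q' V = (if q = q' then 1 else 0)"
  using V(1) unfolding vec_eq_iff by (simp add: matrix_mult_transpose_dot_column mat_def)

lemma unit_inner_unit:
  "unit p q \<bullet> unit p' q' = (if p = p' \<and> q = q' then 1 else 0)"
  by (simp add: inner_outer_prod unit_def outer_prod_mult_vec inner_commute column_U_inner
      column_V_inner)

text \<open>This description by vanishing coordinates replaces the existential over
  \<open>M\<close>, so that the subspace property and monotonicity in \<open>J\<close> can be read
  off.\<close>

lemma RXJ_eq:
  "RXJ \<iota> U V J = {Z. \<forall>p q. \<not> (p \<in> \<iota> ` J \<and> q \<in> J) \<longrightarrow> Z \<bullet> unit p q = 0}"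
proof -
  have sum_eq: "(\<chi> i k. \<Sum>p\<in>J. \<Sum>q\<in>J. U $ i $ \<iota> p * M p q * V $ k $ q)
      = (\<Sum>p\<in>J. \<Sum>q\<in>J. M p q *\<^sub>R unit (\<iota> p) q)" for M
    by (simp add: vec_eq_iff unit_def outer_prod_def column_def ac_simps)
  show ?thesis
  proof (intro equalityI subsetI)
    fix Z assume "Z \<in> RXJ \<iota> U V J"
    then obtain M where "Z = (\<Sum>p\<in>J. \<Sum>q\<in>J. M p q *\<^sub>R unit (\<iota> p) q)"
      unfolding RXJ_def sum_eq by blast
    then show "Z \<in> {Z. \<forall>p q. \<not> (p \<in> \<iota> ` J \<and> q \<in> J) \<longrightarrow> Z \<bullet> unit p q = 0}"
      by (auto simp: inner_sum_left unit_inner_unit intro!: sum.neutral)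
  next
    fix Z assume Z: "Z \<in> {Z. \<forall>p q. \<not> (p \<in> \<iota> ` J \<and> q \<in> J) \<longrightarrow> Z \<bullet> unit p q = 0}"
    \<comment> \<open>The part of \<open>Z\<close> expanded over the block; comparing all
      coordinates gives \<open>Z = W\<close>.\<close>
    define W where "W = (\<Sum>p\<in>J. \<Sum>q\<in>J. (Z \<bullet> unit (\<iota> p) q) *\<^sub>R unit (\<iota> p) q)"
    have "W \<bullet> unit p q = Z \<bullet> unit p q" for p q
    proof (cases "p \<in> \<iota> ` J \<and> q \<in> J")
      case True
      then obtain p' where p': "p = \<iota> p'" "p' \<in> J" by auto
      have "W \<bullet> unit p q =
          (\<Sum>r\<in>J. \<Sum>s\<in>J. if r = p' then (if s = q then Z \<bullet> unit (\<iota> r) s else 0) else 0)"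
        unfolding W_def inner_sum_left inner_scaleR_left unit_inner_unit p'(1) inj_eq[OF inj_iota]
        by (intro sum.cong) auto
      also have "\<dots> = (\<Sum>r\<in>J. if r = p' then (\<Sum>s\<in>J. if s = q then Z \<bullet> unit (\<iota> r) s else 0) else 0)"
        by (intro sum.cong) auto
      also have "\<dots> = Z \<bullet> unit p q" using True p' by simp
      finally show ?thesis .
    next
      case False
      then have "W \<bullet> unit p q = 0"
        by (auto simp: W_def inner_sum_left unit_inner_unit intro!: sum.neutral)
      then show ?thesis using Z False by simp
    qed
    then have "Z = W" using eq_0_if_unit[of "W - Z"] by (simp add: inner_diff_left)
    then show "Z \<in> RXJ \<iota> U V J"
      unfolding RXJ_def sum_eq W_def by (intro CollectI exI[of _ "\<lambda>p q. Z \<bullet> unit (\<iota> p) q"]) simp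
  qed
qed

lemma subspace_RXJ: "subspace (RXJ \<iota> U V J)"
  unfolding RXJ_eq subspace_def by (auto simp: inner_add_left)

lemma RXJ_mono: "J \<subseteq> J' \<Longrightarrow> RXJ \<iota> U V J \<subseteq> RXJ \<iota> U V J'"
  unfolding RXJ_eq by blast

text \<open>A coordinate outside the block pairs \<open>X\<close> with a column of \<open>U\<close>
  in the kernel of \<open>transpose X\<close> or a column of \<open>V\<close> in the kernel of
  \<open>X\<close>.\<close>

lemma X_in_RXJ: "X \<in> RXJ \<iota> U V \<Gamma>"
proof -
  have "X \<bullet> unit p q = 0" if "\<not> (p \<in> \<iota> ` \<Gamma> \<and> q \<in> \<Gamma>)" for p q
  proof (cases "q \<in> \<Gamma>")
    case True
    then have "transpose X *v column p U = 0"
      using that by (intro transpose_X_mult_column_eq_0) auto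
    then show ?thesis
      by (metis unit_def dot_lmul_matrix inner_outer_prod inner_zero_left transpose_matrix_vector)
  qed (simp add: unit_def inner_outer_prod X_mult_column_eq_0)
  then show ?thesis by (simp add: RXJ_eq)
qed

text \<open>\<open>Z\<close> is a product with \<open>coord Z\<close> as a factor, and
  \<open>coord Z\<close> has nonzero columns only at indices in \<open>J\<close>.\<close>

lemma rank_RXJ_le:
  assumes "Z \<in> RXJ \<iota> U V J"
  shows "rank Z \<le> card J"
proof -
  have "Z = (U ** transpose U) ** Z ** (V ** transpose V)" by (simp add: U V)
  also have "\<dots> = U ** coord Z ** transpose V" by (simp add: matrix_mul_assoc)
  finally have "rank Z \<le> rank (coord Z)"
    using rank_mul_le_left[of "U ** coord Z" "transpose V"] rank_mul_le_right[of U "coord Z"]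
    by simp
  also have "\<dots> \<le> card J"
    using assms by (intro rank_le_card_nonzero_columns)
      (auto simp: RXJ_eq column_def vec_eq_iff coord_nth)
  finally show ?thesis .
qed

text \<open>The left singular vectors of the nonzero singular values are orthonormal and lie in the
  range of \<open>X\<close>.\<close>

lemma card_nonzero_sv_le: "card \<Gamma> \<le> rank X"
proof -
  let ?B = "(\<lambda>q. column (\<iota> q) U) ` \<Gamma>"
  have inj: "inj_on (\<lambda>q. column (\<iota> q) U) \<Gamma>"
  proof (rule inj_onI)
    fix q q' assume "column (\<iota> q) U = column (\<iota> q') U"
    then show "q = q'" using column_U_inner[of "\<iota> q" "\<iota> q'"] column_U_inner[of "\<iota> q'" "\<iota> q'"] inj_iota
      by (auto simp: inj_eq split: if_splits)
  qed
  have "column (\<iota> q) U \<noteq> 0" for q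
    using column_U_inner[of "\<iota> q" "\<iota> q"] by auto
  then have "0 \<notin> ?B" by (auto simp: image_iff)
  moreover have "pairwise orthogonal ?B"
    by (auto simp: pairwise_def orthogonal_def column_U_inner)
  ultimately have "independent ?B" by (simp add: pairwise_orthogonal_independent)
  moreover have "?B \<subseteq> range ((*v) X)"
  proof
    fix x assume "x \<in> ?B"
    then obtain q where "\<sigma> $ q \<noteq> 0" "x = column (\<iota> q) U" by (auto simp: nonzero_sv_def)
    then have "x = X *v (column q V /\<^sub>R (\<sigma> $ q))"
      by (simp add: matrix_vector_mult_scaleR X_mult_column)
    then show "x \<in> range ((*v) X)" by blast
  qed
  ultimately have "card ?B \<le> dim (range ((*v) X))" by (intro independent_card_le_dim)
  then show ?thesis using card_image[OF inj] by (simp add: rank_dim_range)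
qed

text \<open>For a nonzero singular value, column \<open>p\<close> of \<open>U\<close> is a multiple
  of \<open>X *v column q' V\<close>, and the factor \<open>X\<close> can be moved onto
  \<open>B\<close> as \<open>transpose X\<close>. The next lemma does the same on the other
  side.\<close>

lemma inner_unit_eq_0_left:
  assumes "transpose X ** B = 0" "p \<in> \<iota> ` \<Gamma>"
  shows "B \<bullet> unit p q = 0"
proof -
  obtain q' where q': "p = \<iota> q'" "\<sigma> $ q' \<noteq> 0" using assms(2) by (auto simp: nonzero_sv_def)
  have "\<sigma> $ q' * (B \<bullet> unit p q) = (X *v column q' V) \<bullet> (B *v column q V)"
    by (simp add: unit_def inner_outer_prod X_mult_column q'(1))
  also have "\<dots> = column q' V \<bullet> ((transpose X ** B) *v column q V)"
    by (metis dot_lmul_matrix matrix_vector_mul_assoc transpose_transpose transpose_matrix_vector)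
  also have "\<dots> = 0" using assms(1) by simp
  finally show ?thesis using q' by simp
qed

lemma inner_unit_eq_0_right:
  assumes "B ** transpose X = 0" "q \<in> \<Gamma>"
  shows "B \<bullet> unit p q = 0"
proof -
  have "\<sigma> $ q * (B \<bullet> unit p q) = column p U \<bullet> (B *v (transpose X *v column (\<iota> q) U))"
    by (simp only: unit_def inner_outer_prod transpose_X_mult_column_image matrix_vector_mult_scaleR
        inner_scaleR_right)
  also have "\<dots> = column p U \<bullet> ((B ** transpose X) *v column (\<iota> q) U)"
    by (simp only: matrix_vector_mul_assoc)
  also have "\<dots> = 0" using assms(1) by simp
  finally show ?thesis using assms(2) by (simp add: nonzero_sv_def)
qed

lemma T_block_sum:
  "(\<Sum>i\<in>I. u i *\<^sub>R T_block \<iota> U \<sigma> V (A i)) = T_block \<iota> U \<sigma> V (\<Sum>i\<in>I. u i *\<^sub>R A i)"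
proof -
  have "(\<Sum>i\<in>I. u i *\<^sub>R T_block \<iota> U \<sigma> V (A i)) $ p $ q = T_block \<iota> U \<sigma> V (\<Sum>i\<in>I. u i *\<^sub>R A i) $ p $ q" for p q
    by (cases "p \<in> \<iota> ` \<Gamma>"; cases "q \<in> \<Gamma>") (simp_all add: T_block_def coord_nth inner_sum_left)
  then show ?thesis by (simp add: vec_eq_iff)
qed

lemma R_block_sum:
  "(\<Sum>i\<in>I. u i *\<^sub>R R_block \<iota> U \<sigma> V (A i)) = R_block \<iota> U \<sigma> V (\<Sum>i\<in>I. u i *\<^sub>R A i)"
proof -
  have "(\<Sum>i\<in>I. u i *\<^sub>R R_block \<iota> U \<sigma> V (A i)) $ p $ q = R_block \<iota> U \<sigma> V (\<Sum>i\<in>I. u i *\<^sub>R A i) $ p $ q" for p q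
    by (cases "p \<in> \<iota> ` \<Gamma>"; cases "q \<in> \<Gamma>") (simp_all add: R_block_def coord_nth inner_sum_left)
  then show ?thesis by (simp add: vec_eq_iff)
qed

lemma T_block_eq_0:
  assumes "B ** transpose X = 0" "transpose X ** B = 0"
  shows "T_block \<iota> U \<sigma> V B = 0"
  using inner_unit_eq_0_left[OF assms(2)] inner_unit_eq_0_right[OF assms(1)]
  by (auto simp: vec_eq_iff T_block_def coord_nth)

text \<open>Each coordinate vanishes in one of the two factors: in \<open>G\<close> if
  \<open>p\<close> or \<open>q\<close> belongs to a nonzero singular value, and in
  \<open>\<Xi>\<close> otherwise, by the kernel argument.\<close>

lemma normal_rank_le_full:
  assumes "G ** transpose X = 0" "transpose X ** G = 0"
    and \<Xi>: "\<Xi> \<in> bouligand_tangent_cone (rank_le (rank X)) X"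
  shows "G \<bullet> \<Xi> = 0"
proof -
  have "(G \<bullet> unit p q) * (\<Xi> \<bullet> unit p q) = 0" for p q
  proof (cases "p \<in> \<iota> ` \<Gamma> \<or> q \<in> \<Gamma>")
    case True
    then show ?thesis
      using inner_unit_eq_0_left[OF assms(2)] inner_unit_eq_0_right[OF assms(1)] by auto
  next
    case False
    then have "column p U \<bullet> (\<Xi> *v column q V) = 0"
      by (intro tangent_rank_le_kernel[OF \<Xi>] X_mult_column_eq_0 transpose_X_mult_column_eq_0)
        blast+
    then show ?thesis by (simp add: unit_def inner_outer_prod)
  qed
  then show ?thesis by (subst inner_eq_sum_unit) (simp only: sum.neutral_const)
qed

text \<open>If no admissible \<open>J\<close> contains both indices, every member of
  \<open>RX\<close> has a zero coordinate there, so \<open>unit p q\<close> is orthogonal to all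
  tangent directions.\<close>

lemma in_frechet_normal_cone_RX:
  assumes "\<And>J. \<Gamma> \<subseteq> J \<Longrightarrow> card J = r \<Longrightarrow> \<not> (p \<in> \<iota> ` J \<and> q \<in> J)"
  shows "unit p q \<in> frechet_normal_cone (RX \<iota> U \<sigma> V r) X"
proof -
  have "unit p q \<bullet> (Y - X) = 0" if Y: "Y \<in> RX \<iota> U \<sigma> V r" for Y
  proof -
    obtain J where J: "card J = r" "\<Gamma> \<subseteq> J" "Y \<in> RXJ \<iota> U V J" using Y by (auto simp: RX_def)
    then have "X \<in> RXJ \<iota> U V J" using X_in_RXJ RXJ_mono by blast
    with J have "Y - X \<in> RXJ \<iota> U V J" using subspace_RXJ subspace_diff by blast
    then show ?thesis using assms J by (auto simp: RXJ_eq inner_commute)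
  qed
  then have "unit p q \<bullet> \<Xi> = 0" if "\<Xi> \<in> bouligand_tangent_cone (RX \<iota> U \<sigma> V r) X" for \<Xi>
    using bouligand_tangent_cone_orthogonal[OF that] by blast
  then show ?thesis by (simp add: frechet_normal_cone_def polar_def)
qed

section \<open>Stationarity of local minimizers\<close>

lemma stationary_of_local_minimizer_full_rank:
  assumes f: "continuous_on UNIV f" "GDERIV f X :> g"
    and min: "local_minimizer_on f (affine_constraints l A b \<inter> rank_le (rank X)) X"
    and indep: "assumption1 \<iota> U \<sigma> V l A"
  shows "F_stationary f l A b (rank X) X"
proof -
  obtain e where X: "X \<in> affine_constraints l A b" and e: "e > 0"
      "\<And>Y. Y \<in> affine_constraints l A b \<inter> rank_le (rank X) \<Longrightarrow> dist Y X < e \<Longrightarrow> f X \<le> f Y"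
    using min unfolding local_minimizer_on_def by auto
  define \<Phi> where "\<Phi> z = fst z ** X ** snd z" for z :: "(real^'m^'m) \<times> (real^'n^'n)"
  let ?x = "(mat 1, mat 1) :: (real^'m^'m) \<times> (real^'n^'n)"
  have \<Phi>_x: "\<Phi> ?x = X" by (simp add: \<Phi>_def)
  have cont_\<Phi>: "continuous_on UNIV \<Phi>"
    unfolding \<Phi>_def
    by (intro bounded_bilinear.continuous_on[OF bounded_bilinear_matrix_matrix_mult] continuous_intros)
  \<comment> \<open>Continuity at the identity pair turns the radius \<open>e\<close> around
    \<open>X\<close> into a radius for the pair.\<close>
  obtain \<delta> where \<delta>: "\<delta> > 0" "\<And>z. dist z ?x < \<delta> \<Longrightarrow> dist (\<Phi> z) X < e"
    using cont_\<Phi> e(1) \<Phi>_x unfolding continuous_on_iff by (metis UNIV_I)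
  have rank_\<Phi>: "\<Phi> z \<in> rank_le (rank X)" for z
    unfolding \<Phi>_def rank_le_def
    using rank_mul_le_left[of "fst z ** X" "snd z"] rank_mul_le_right[of "fst z" X] by simp
  obtain y where y: "(g ** transpose X, transpose X ** g)
      + (\<Sum>i=1..l. y i *\<^sub>R (A i ** transpose X, transpose X ** A i)) = 0"
  proof (rule lagrange_multipliers[where h = "\<lambda>z. f (\<Phi> z)" and c = "\<lambda>i z. A i \<bullet> \<Phi> z"
        and x = ?x and e = \<delta> and l = l])
    show "continuous_on UNIV (\<lambda>z. f (\<Phi> z))"
      by (rule continuous_on_compose2[OF f(1) cont_\<Phi>]) auto
    show "GDERIV (\<lambda>z. f (\<Phi> z)) ?x :> (g ** transpose X, transpose X ** g)"
      unfolding \<Phi>_def using f(2) by (rule gderiv_mult_both_sides)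
    show "continuous_on UNIV (\<lambda>z. A i \<bullet> \<Phi> z)" for i
      by (intro continuous_intros cont_\<Phi>)
    show "GDERIV (\<lambda>z. A i \<bullet> \<Phi> z) ?x :> (A i ** transpose X, transpose X ** A i)" for i
      unfolding \<Phi>_def
      by (rule gderiv_mult_both_sides[where F = "\<lambda>Z. A i \<bullet> Z"])
        (auto simp: gderiv_def inner_commute intro!: derivative_eq_intros)
    show "u i = 0" if "(\<Sum>i=1..l. u i *\<^sub>R (A i ** transpose X, transpose X ** A i)) = 0" "i \<in> {1..l}"
      for u :: "nat \<Rightarrow> real" and i
    proof -
      \<comment> \<open>A vanishing combination of the pulled back gradients forces the same
        combination of the \<open>A i\<close> to have zero \<open>T_block\<close>; by Assumption 1
        its coefficients are then zero.\<close>
      define B where "B = (\<Sum>i=1..l. u i *\<^sub>R A i)"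
      have "(B ** transpose X, transpose X ** B) = 0"
        using that(1) gradient_family_sum[where g = 0 and A = A and y = u and X = X and l = l]
        by (simp add: B_def zero_prod_def)
      then have "T_block \<iota> U \<sigma> V B = 0" by (intro T_block_eq_0) (simp_all add: prod_eq_iff)
      then have "(\<Sum>i=1..l. u i *\<^sub>R T_block \<iota> U \<sigma> V (A i)) = 0"
        unfolding B_def T_block_sum .
      from independent_family_sum_eq_0[OF indep[unfolded assumption1_def] this that(2)]
      show ?thesis .
    qed
    show "\<delta> > 0" by fact
    show "f (\<Phi> ?x) \<le> f (\<Phi> z)" if "\<forall>i\<in>{1..l}. A i \<bullet> \<Phi> z = A i \<bullet> \<Phi> ?x" "dist z ?x < \<delta>" for z
      using that X e(2)[of "\<Phi> z"] \<delta>(2)[of z] rank_\<Phi>[of z]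
      unfolding \<Phi>_x affine_constraints_def by auto
  qed blast
  define G where "G = g + (\<Sum>i=1..l. y i *\<^sub>R A i)"
  have "G ** transpose X = 0" "transpose X ** G = 0"
    using y unfolding gradient_family_sum G_def by (simp_all add: prod_eq_iff)
  then have "- G \<in> frechet_normal_cone (rank_le (rank X)) X"
    by (simp add: frechet_normal_cone_def polar_def normal_rank_le_full)
  moreover have "GDERIV (\<lambda>Z. lagrangian f l A b Z y) X :> G"
    unfolding G_def using f(2) by (rule gderiv_lagrangian)
  moreover have "\<forall>i\<in>{1..l}. A i \<bullet> X = b i" using X by (simp add: affine_constraints_def)
  ultimately show ?thesis unfolding F_stationary_def by (auto simp: rank_le_def)
qed

lemma stationary_of_local_minimizer_deficient_rank:
  assumes f: "GDERIV f X :> g"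
    and min: "local_minimizer_on f (affine_constraints l A b \<inter> rank_le r) X"
    and r: "rank X < r" "r < CARD('n)"
    and indep: "assumption2 \<iota> U \<sigma> V l A"
    and normal: "frechet_normal_cone (RX \<iota> U \<sigma> V r) X
      \<subseteq> bouligand_tangent_cone (affine_constraints l A b) X"
  shows "F_stationary f l A b r X"
proof -
  have X: "\<And>i. i \<in> {1..l} \<Longrightarrow> A i \<bullet> X = b i"
    using min by (auto simp: local_minimizer_on_def affine_constraints_def)
  have line: "g \<bullet> D = 0"
    if "\<And>t. rank (X + t *\<^sub>R D) \<le> r" "\<forall>i\<in>{1..l}. A i \<bullet> D = 0" for D
    using that X
    by (intro local_minimizer_gradient_line[OF min f])
      (auto simp: affine_constraints_def rank_le_def inner_add_right)
  define G where "G y = g + (\<Sum>i=1..l. y i *\<^sub>R A i)" for y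
  have multipliers: "\<exists>y. \<forall>D\<in>RXJ \<iota> U V J. G y \<bullet> D = 0" if J: "\<Gamma> \<subseteq> J" "card J = r" for J
    unfolding G_def
  proof (rule linear_multipliers_on_subspace[OF subspace_RXJ line])
    fix D t assume D: "D \<in> RXJ \<iota> U V J"
    have "X \<in> RXJ \<iota> U V J" using X_in_RXJ RXJ_mono J by blast
    then have "X + t *\<^sub>R D \<in> RXJ \<iota> U V J"
      using D subspace_RXJ by (blast intro: subspace_add subspace_scale)
    then show "rank (X + t *\<^sub>R D) \<le> r" using rank_RXJ_le J(2) by blast
  qed
  \<comment> \<open>The comparison takes place on \<open>RXJ \<iota> U V \<Gamma>\<close>, which is
    contained in every admissible subspace. It sees exactly the entries kept by
    \<open>R_block\<close>, so Assumption 2 applies.\<close>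
  have unique: "\<forall>i\<in>{1..l}. y i = y' i"
    if "\<forall>D\<in>RXJ \<iota> U V \<Gamma>. G y \<bullet> D = 0" "\<forall>D\<in>RXJ \<iota> U V \<Gamma>. G y' \<bullet> D = 0" for y y'
  proof -
    define B where "B = (\<Sum>i=1..l. (y i - y' i) *\<^sub>R A i)"
    have "B = G y - G y'"
      by (simp add: B_def G_def algebra_simps sum_subtractf)
    then have "B \<bullet> D = 0" if "D \<in> RXJ \<iota> U V \<Gamma>" for D
      using \<open>\<forall>D\<in>RXJ \<iota> U V \<Gamma>. G y \<bullet> D = 0\<close> \<open>\<forall>D\<in>RXJ \<iota> U V \<Gamma>. G y' \<bullet> D = 0\<close> that
      by (simp add: inner_diff_left)
    then have "B \<bullet> unit p q = 0" if "p \<in> \<iota> ` \<Gamma>" "q \<in> \<Gamma>" for p q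
      using that by (auto simp: RXJ_eq unit_inner_unit)
    then have "R_block \<iota> U \<sigma> V B = 0"
      by (auto simp: vec_eq_iff R_block_def coord_nth)
    then have "(\<Sum>i=1..l. (y i - y' i) *\<^sub>R R_block \<iota> U \<sigma> V (A i)) = 0"
      unfolding B_def R_block_sum .
    from independent_family_sum_eq_0[OF indep[unfolded assumption2_def] this]
    show ?thesis by auto
  qed
  \<comment> \<open>The multipliers of any one admissible set will serve for all of them.\<close>
  obtain J0 where J0: "\<Gamma> \<subseteq> J0" "card J0 = r"
    using exists_subset_between[of \<Gamma> r UNIV] card_nonzero_sv_le r by auto
  obtain y where y: "\<forall>D\<in>RXJ \<iota> U V J0. G y \<bullet> D = 0" using multipliers J0 by blast
  have "G y \<bullet> unit p q = 0" for p q
  proof (cases "\<exists>J. \<Gamma> \<subseteq> J \<and> card J = r \<and> p \<in> \<iota> ` J \<and> q \<in> J")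
    case True
    then obtain J where J: "\<Gamma> \<subseteq> J" "card J = r" "p \<in> \<iota> ` J" "q \<in> J" by blast
    obtain y' where y': "\<forall>D\<in>RXJ \<iota> U V J. G y' \<bullet> D = 0" using multipliers J by blast
    have "\<forall>i\<in>{1..l}. y i = y' i"
      using y y' RXJ_mono[OF J0(1)] RXJ_mono[OF J(1)] by (intro unique) blast+
    then have "G y = G y'" by (simp add: G_def)
    moreover have "unit p q \<in> RXJ \<iota> U V J" using J by (auto simp: RXJ_eq unit_inner_unit)
    ultimately show ?thesis using y' by simp
  next
    \<comment> \<open>This happens if \<open>p\<close> is outside the range of
      \<open>\<iota>\<close>, or if adjoining both indices to \<open>\<Gamma>\<close> gives more
      than \<open>r\<close> elements. The direction then respects the linear constraints, and since
      \<open>rank X < r\<close> the line along it respects the rank bound.\<close>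
    case False
    then have "unit p q \<in> bouligand_tangent_cone (affine_constraints l A b) X"
      using in_frechet_normal_cone_RX[of r p q] normal by blast
    then have A0: "A i \<bullet> unit p q = 0" if "i \<in> {1..l}" for i
      by (rule bouligand_tangent_cone_orthogonal)
        (use X that in \<open>simp add: affine_constraints_def inner_diff_right\<close>)
    moreover have "g \<bullet> unit p q = 0"
    proof (rule line)
      show "rank (X + t *\<^sub>R unit p q) \<le> r" for t
        using rank_add_outer_prod[of X t "column p U" "column q V"] r(1) unfolding unit_def by linarith
    qed (use A0 in blast)
    ultimately show ?thesis by (simp add: G_def inner_add_left inner_sum_left)
  qed
  then have "G y = 0" by (rule eq_0_if_unit)
  moreover have "GDERIV (\<lambda>Z. lagrangian f l A b Z y) X :> G y"
    unfolding G_def using f by (rule gderiv_lagrangian)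
  ultimately show ?thesis
    using X r(1) unfolding F_stationary_def
    by (auto simp: rank_le_def frechet_normal_cone_def polar_def intro!: exI[of _ y] exI[of _ 0])
qed

end

section \<open>Stationarity and convexity\<close>

text \<open>A rank-one change keeps the rank at most \<open>r\<close>, so the tangent cone contains
  every rank-one matrix together with its negative. This leaves only the zero normal.\<close>

lemma normal_rank_le_deficient_eq_0:
  fixes G X :: "real^'n^'m"
  assumes "rank X < r" "- G \<in> frechet_normal_cone (rank_le r) X"
  shows "G = 0"
proof -
  have "u \<bullet> (G *v v) = 0" for u v
  proof -
    have "rank (X + t *\<^sub>R outer_prod (c *\<^sub>R u) v) \<le> r" for c t
      using assms(1) rank_add_outer_prod[of X t "c *\<^sub>R u" v] by linarith
    then have "outer_prod (c *\<^sub>R u) v \<in> bouligand_tangent_cone (rank_le r) X" for c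
      by (intro line_in_bouligand_tangent_cone) (simp add: rank_le_def)
    then have "0 \<le> G \<bullet> outer_prod (c *\<^sub>R u) v" for c
      using assms(2) by (auto simp: frechet_normal_cone_def polar_def)
    from this[of 1] this[of "-1"] show ?thesis
      by (simp add: inner_outer_prod)
  qed
  then have "G *v v = 0" for v using inner_eq_zero_iff by blast
  then show ?thesis by (simp add: matrix_eq)
qed

text \<open>The multiplier terms are constant on the affine set, so between feasible points the
  gradient inequality of the convex \<open>f\<close> can be written with \<open>G\<close>.\<close>

lemma stationary_convex_le:
  assumes "convex_on UNIV f" "GDERIV (\<lambda>Z. lagrangian f l A b Z y) X :> G"
    and X: "X \<in> affine_constraints l A b" and Y: "Y \<in> affine_constraints l A b"
    and "G \<bullet> (Y - X) \<ge> 0"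
  shows "f X \<le> f Y"
proof -
  \<comment> \<open>Adding the constraint terms with negated multipliers to the Lagrangian recovers
    \<open>f\<close>, and so its gradient at \<open>X\<close>.\<close>
  have "GDERIV (\<lambda>Z. lagrangian f l A b Z y + (\<Sum>i=1..l. (- y i) * (A i \<bullet> Z - b i))) X
      :> G + (\<Sum>i=1..l. (- y i) *\<^sub>R A i)"
    using gderiv_lagrangian[OF assms(2), of l A b "\<lambda>i. - y i"] by (simp only: lagrangian_def)
  then have fgrad: "GDERIV f X :> G + (\<Sum>i=1..l. (- y i) *\<^sub>R A i)"
    by (simp add: lagrangian_def sum_negf)
  have "f X + g' \<bullet> (Y - X) \<le> f Y" if "GDERIV f X :> g'" for g'
  proof -
    \<comment> \<open>Convexity bounds these difference quotients by \<open>f Y - f X\<close> for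
      \<open>t\<close> between 0 and 1; their limit from the right is the directional
      derivative.\<close>
    define q where "q t = (f (X + t *\<^sub>R (Y - X)) - f X) / t" for t
    have "(q \<longlongrightarrow> g' \<bullet> (Y - X)) (at 0)"
      using gderiv_line[OF that, of "Y - X"] by (simp add: DERIV_def q_def[abs_def])
    then have "(q \<longlongrightarrow> g' \<bullet> (Y - X)) (at_right 0)"
      by (rule tendsto_within_subset) simp
    moreover have "q t \<le> f Y - f X" if "0 < t" "t < 1" for t
    proof -
      have "f ((1 - t) *\<^sub>R X + t *\<^sub>R Y) \<le> (1 - t) * f X + t * f Y"
        by (rule convex_onD[OF assms(1)]) (use \<open>0 < t\<close> \<open>t < 1\<close> in simp_all)
      moreover have "(1 - t) *\<^sub>R X + t *\<^sub>R Y = X + t *\<^sub>R (Y - X)"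
        by (simp add: algebra_simps)
      ultimately show ?thesis
        using \<open>0 < t\<close> by (simp add: q_def field_simps)
    qed
    then have "\<forall>\<^sub>F t in at_right 0. q t \<le> f Y - f X"
      by (intro eventually_at_rightI[of 0 1]) simp_all
    ultimately have "g' \<bullet> (Y - X) \<le> f Y - f X"
      by (rule tendsto_upperbound) simp
    then show ?thesis by simp
  qed
  from this[OF fgrad]
  have "f X + (G \<bullet> (Y - X) - (\<Sum>i=1..l. y i * (A i \<bullet> (Y - X)))) \<le> f Y"
    by (simp add: inner_diff_left inner_sum_left sum_negf)
  moreover have "(\<Sum>i=1..l. y i * (A i \<bullet> (Y - X))) = 0"
    using X Y by (intro sum.neutral) (simp add: affine_constraints_def inner_diff_right)
  ultimately show ?thesis using assms(5) by simp
qed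

theorem theorem3p1:
  fixes f :: "real^'n^'m \<Rightarrow> real"
    and A :: "nat \<Rightarrow> real^'n^'m" and b :: "nat \<Rightarrow> real"
    and l r s :: nat
    and X :: "real^'n^'m"
    and \<iota> :: "'n \<Rightarrow> 'm" and U :: "real^'m^'m" and \<sigma> :: "real^'n" and V :: "real^'n^'n"
  assumes "CARD('m) \<ge> CARD('n)"
    and "1 \<le> r" and "r < CARD('n)"
    and "continuously_differentiable f"
    and "X \<in> affine_constraints l A b \<inter> rank_le r"
    and "rank X = s"
    and "is_svd \<iota> X U \<sigma> V"
  shows
    "(local_minimizer_on f (affine_constraints l A b \<inter> rank_le r) X \<longrightarrow>
       (s = r \<and> assumption1 \<iota> U \<sigma> V l A) \<or>
       (s < r \<and> assumption2 \<iota> U \<sigma> V l A \<and>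
        frechet_normal_cone (RX \<iota> U \<sigma> V r) X
          \<subseteq> bouligand_tangent_cone (affine_constraints l A b) X) \<longrightarrow>
       F_stationary f l A b r X) \<and>
     (convex_on UNIV f \<and> F_stationary f l A b r X \<longrightarrow>
       (s = r \<longrightarrow>
         global_minimizer_on f
           (affine_constraints l A b \<inter> rank_le r \<inter> RXJ \<iota> U V (nonzero_sv \<sigma>)) X) \<and>
       (s < r \<longrightarrow>
         global_minimizer_on f (affine_constraints l A b \<inter> rank_le r) X))"
proof -
  have svd: "svd \<iota> X U \<sigma> V" using assms(7) by (rule svd.intro)
  note subspace_RXJ = svd.subspace_RXJ[OF svd] and X_in_RXJ = svd.X_in_RXJ[OF svd]
    and rank_RXJ_le = svd.rank_RXJ_le[OF svd] and card_nonzero_sv_le = svd.card_nonzero_sv_le[OF svd]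
  obtain g where "\<And>Z. GDERIV f Z :> g Z"
    using assms(4) unfolding continuously_differentiable_def by blast
  then have f: "continuous_on UNIV f" "GDERIV f X :> g X"
    by (auto simp: gderiv_def continuous_on_eq_continuous_at intro: has_derivative_continuous)
  have "F_stationary f l A b r X"
    if "local_minimizer_on f (affine_constraints l A b \<inter> rank_le r) X"
      "(s = r \<and> assumption1 \<iota> U \<sigma> V l A) \<or>
       (s < r \<and> assumption2 \<iota> U \<sigma> V l A \<and>
        frechet_normal_cone (RX \<iota> U \<sigma> V r) X
          \<subseteq> bouligand_tangent_cone (affine_constraints l A b) X)"
    using that(2)
  proof (elim disjE conjE)
    assume "s = r" "assumption1 \<iota> U \<sigma> V l A"
    then show ?thesis
      using svd.stationary_of_local_minimizer_full_rank[OF svd f] that(1) assms(6) by blast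
  next
    assume "s < r" "assumption2 \<iota> U \<sigma> V l A"
      "frechet_normal_cone (RX \<iota> U \<sigma> V r) X
        \<subseteq> bouligand_tangent_cone (affine_constraints l A b) X"
    then show ?thesis
      using svd.stationary_of_local_minimizer_deficient_rank[OF svd f(2) that(1)] assms(3,6) by blast
  qed
  moreover have "global_minimizer_on f
      (affine_constraints l A b \<inter> rank_le r \<inter> RXJ \<iota> U V (nonzero_sv \<sigma>)) X"
    if "convex_on UNIV f" "F_stationary f l A b r X" "s = r"
  proof -
    from \<open>F_stationary f l A b r X\<close> obtain y G where G: "GDERIV (\<lambda>Z. lagrangian f l A b Z y) X :> G"
        "- G \<in> frechet_normal_cone (rank_le r) X"
      unfolding F_stationary_def by blast
    \<comment> \<open>There are at most \<open>rank X = r\<close> nonzero singular values, so the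
      subspace consists of matrices of admissible rank. It therefore contains the whole line through
      \<open>X\<close> and \<open>Y\<close>, which makes \<open>Y - X\<close> tangent.\<close>
    have "rank Z \<le> r" if "Z \<in> RXJ \<iota> U V (nonzero_sv \<sigma>)" for Z
      using rank_RXJ_le[OF that] card_nonzero_sv_le assms(6) \<open>s = r\<close> by linarith
    then have RXJ_rank: "RXJ \<iota> U V (nonzero_sv \<sigma>) \<subseteq> rank_le r"
      by (auto simp: rank_le_def)
    have "f X \<le> f Y" if Y: "Y \<in> affine_constraints l A b" "Y \<in> RXJ \<iota> U V (nonzero_sv \<sigma>)" for Y
    proof (rule stationary_convex_le[OF \<open>convex_on UNIV f\<close> G(1) _ Y(1)])
      have "X + t *\<^sub>R (Y - X) \<in> RXJ \<iota> U V (nonzero_sv \<sigma>)" for t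
        using Y(2) X_in_RXJ subspace_RXJ by (blast intro: subspace_add subspace_scale subspace_diff)
      then have "X + t *\<^sub>R (Y - X) \<in> rank_le r" for t
        using RXJ_rank by blast
      then have "Y - X \<in> bouligand_tangent_cone (rank_le r) X"
        by (rule line_in_bouligand_tangent_cone)
      then show "G \<bullet> (Y - X) \<ge> 0"
        using G(2) by (auto simp: frechet_normal_cone_def polar_def)
    qed (use assms(5) in blast)
    then show ?thesis using assms(5) X_in_RXJ by (simp add: global_minimizer_on_def)
  qed
  moreover have "global_minimizer_on f (affine_constraints l A b \<inter> rank_le r) X"
    if "convex_on UNIV f" "F_stationary f l A b r X" "s < r"
  proof -
    from \<open>F_stationary f l A b r X\<close> obtain y G where G: "GDERIV (\<lambda>Z. lagrangian f l A b Z y) X :> G"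
        "- G \<in> frechet_normal_cone (rank_le r) X"
      unfolding F_stationary_def by blast
    \<comment> \<open>With \<open>G = 0\<close> the convexity inequality applies to every point of
      the affine set.\<close>
    have "G = 0" using normal_rank_le_deficient_eq_0 G(2) \<open>s < r\<close> assms(6) by blast
    then have "f X \<le> f Y" if "Y \<in> affine_constraints l A b" for Y
      using stationary_convex_le[OF \<open>convex_on UNIV f\<close> G(1) _ that] assms(5) by simp
    then show ?thesis using assms(5) by (simp add: global_minimizer_on_def)
  qed
  ultimately show ?thesis by blast
qed

end
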